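(* Let $Q\subseteq\mathbb{R}^m$ be a closed set, let $g_1,\ldots,g_s\in\mathbb{R}[\mathrm{x},\mathrm{y}]$, and let $K=\{x\in\mathbb{R}^n : g_1(x,y)\ge 0,\ldots,g_s(x,y)\ge 0\ \ \forall y\in Q\}$. Let $\nu$ be a nonnegative Borel measure on $\mathbb{R}^m$ with $\operatorname{supp}(\nu)=Q$ satisfying the multivariate Carleman condition. Let $c_{eq}=(c_i)_{i\in\mathcal{I}}$ and $c_{in}=(c_j)_{j\in\mathcal{J}}$ be finite tuples of polynomials in $\mathbb{R}[\mathrm{x}]$ (with $\mathcal{I},\mathcal{J}$ disjoint finite index sets), let $X=\{x\in\mathbb{R}^n: c_i(x)=0\ (i\in\mathcal{I}),\ c_j(x)\ge0\ (j\in\mathcal{J})\}$, and let $f\in\mathbb{R}[\mathrm{x}]$. Assume that $\operatorname{QM}[g,\nu]+\operatorname{Ideal}[c_{eq}]+\operatorname{QM}[c_{in}]$ is archimedean. Then the optimal value $f_{\min}$ of the semi-infinite program of minimizing $f(x)$ over $x\in X$ subject to $g_j(x,y)\ge0$ for all $y\in Q$ and all $j=1,\ldots,s$ (that is, over $x\in X\cap K$) is equal to the optimal value of the optimization problem $$\left\{\begin{array}{rl}\min & \mathscr{R}_z(f)\\ \text{s.t.} & \mathscr{R}_z\ge0\ \text{ on }\ \operatorname{QM}[g,\nu]+\operatorname{Ideal}[c_{eq}]+\operatorname{QM}[c_{in}],\\ & \mathscr{R}_z(1)=1,\quad z\in\mathbb{R}^{\mathbb{N}^n}.\end{array}\ri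ght.$$
   Context: Here $\mathrm{x}=(\mathrm{x}_1,\ldots,\mathrm{x}_n)$ and $\mathrm{y}=(\mathrm{y}_1,\ldots,\mathrm{y}_m)$ are tuples of variables; $\mathbb{N}$ is the set of nonnegative integers. All measures are finite, and $\nu$ has finite moments of all orders. The measure $\nu$ satisfies the multivariate Carleman condition if $\sum_{d=1}^\infty\big(\int y_j^{2d}\,d\nu(y)\big)^{-\frac{1}{2d}}=\infty$ for $j=1,\ldots,m$ (a term with zero moment is read as $+\infty$). $\Sigma^2[\cdot]$ denotes the cone of sums of squares of polynomials in the indicated variables. With $g_0:=1$, define $$\operatorname{QM}[g,\nu]:=\Big\{\sum_{j=0}^s\int \tau_j(\mathrm{x},y)g_j(\mathrm{x},y)\,d\nu(y)\ :\ \tau_0,\ldots,\tau_s\in\Sigma^2[\mathrm{x},\mathrm{y}]\Big\},$$ $\operatorname{QM}[c_{in}]:=\{\sigma_0+\sum_{j\in\mathcal{J}}\sigma_jc_j:\sigma_0,\sigma_j\in\Sigma^2[\mathrm{x}]\}$, and let $\operatorname{Ideal}[c_{eq}]$ be the ideal of $\mathbb{R}[\mathrm{x}]$ generated by the $c_i$, $i\in\mathcal{I}$. A subset $M\subseteq\mathbb{R}[\mathrm{x}]$ of this kind is archimedean if $N-\mathrm{x}_1^2-\cdots-\mathrm{x}_n^2\in M$ for some integer $N>0$. The Riesz functional of $z=(z_\alpha)_{\alpha\in\mathbb{N}^n}$ is the linear functional $\mathscr{R}_z:\mathbb{R}[\mathrm{x}]\to\mathbb{R}$ with $\mathscr{R}_z(\mathrm{x}^\alpha)=z_\alpha$;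 "$\mathscr{R}_z\ge0$ on $S$" means $\mathscr{R}_z(p)\ge0$ for all $p\in S$. The optimal value of an infeasible minimization problem is $+\infty$. *)

theory Defs
  imports "HOL-Analysis.Analysis" "HOL-Library.Poly_Mapping"
begin

text \<open>Real polynomials in variables indexed by a type; \<open>\<real>[x,y]\<close> is the ring over the sum of the
  index types of \<open>x\<close> and \<open>y\<close>.\<close>
type_synonym 'v mpoly = "('v \<Rightarrow>\<^sub>0 nat) \<Rightarrow>\<^sub>0 real"

definition var :: "'v \<Rightarrow> 'v mpoly" where
  "var i = Poly_Mapping.single (Poly_Mapping.single i 1) 1"

definition monom_eval :: "('v::finite \<Rightarrow> real) \<Rightarrow> ('v \<Rightarrow>\<^sub>0 nat) \<Rightarrow> real" where
  "monom_eval a \<alpha> = (\<Prod>i\<in>UNIV. a i ^ Poly_Mapping.lookup \<alpha> i)"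

definition mpoly_eval :: "('v::finite \<Rightarrow> real) \<Rightarrow> 'v mpoly \<Rightarrow> real" where
  "mpoly_eval a p = (\<Sum>\<alpha>\<in>Poly_Mapping.keys p. Poly_Mapping.lookup p \<alpha> * monom_eval a \<alpha>)"

definition poly_at :: "'n mpoly \<Rightarrow> real ^ 'n \<Rightarrow> real" where
  "poly_at p x = mpoly_eval (\<lambda>i. x $ i) p"

definition poly_at2 :: "('n + 'm) mpoly \<Rightarrow> real ^ 'n \<Rightarrow> real ^ 'm \<Rightarrow> real" where
  "poly_at2 p x y = mpoly_eval (case_sum (\<lambda>i. x $ i) (\<lambda>j. y $ j)) p"

definition sos :: "'v mpoly set" where
  "sos = {\<Sum>i<k. (q i)\<^sup>2 | (k::nat) q. True}"

definition measure_support :: "'a::topological_space measure \<Rightarrow> 'a set" where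
  "measure_support \<nu> = {y. \<forall>U. open U \<and> y \<in> U \<longrightarrow> emeasure \<nu> U > 0}"

definition finite_moments :: "(real ^ 'm) measure \<Rightarrow> bool" where
  "finite_moments \<nu> \<longleftrightarrow> (\<forall>\<beta>. integrable \<nu> (\<lambda>y. monom_eval (\<lambda>j. y $ j) \<beta>))"

definition carleman_term :: "(real ^ 'm) measure \<Rightarrow> 'm \<Rightarrow> nat \<Rightarrow> ennreal" where
  "carleman_term \<nu> j d =
    (let M = (\<integral>y. (y $ j) ^ (2 * d) \<partial>\<nu>)
     in if M = 0 then \<infinity> else ennreal (M powr (- 1 / (2 * real d))))"

text \<open>The sum starts at \<open>d = 1\<close>.\<close>
definition multivariate_carleman :: "(real ^ 'm) measure \<Rightarrow> bool" where
  "multivariate_carleman \<nu> \<longleftrightarrow> (\<forall>j. suminf (\<lambda>d. carleman_term \<nu> j (Suc d)) = \<infinity>)"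

text \<open>The polynomial \<open>\<integral> p(x,y) d\<nu>(y)\<close> in \<open>x\<close>: in each monomial of \<open>p\<close>, with exponent \<open>\<gamma>\<close>, the factor
  \<open>y\<^sup>\<beta>\<close> is replaced by its \<open>\<nu>\<close>-integral. Here \<open>map_key Inl \<gamma>\<close> and \<open>map_key Inr \<gamma>\<close> are the
  restrictions of \<open>\<gamma>\<close> to the \<open>x\<close>- and the \<open>y\<close>-variables.\<close>
definition partial_integral :: "(real ^ 'm) measure \<Rightarrow> ('n + 'm) mpoly \<Rightarrow> 'n mpoly" where
  "partial_integral \<nu> p = (\<Sum>\<gamma>\<in>Poly_Mapping.keys p.
     Poly_Mapping.single (Poly_Mapping.map_key Inl \<gamma>)
       (Poly_Mapping.lookup p \<gamma> *
        (\<integral>y. monom_eval (\<lambda>j. y $ j) (Poly_Mapping.map_key Inr \<gamma>) \<partial>\<nu>)))"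

text \<open>\<open>g\<close> lists \<open>g\<^sub>1, \<dots>, g\<^sub>s\<close>; index \<open>0\<close> stands for \<open>g\<^sub>0 = 1\<close>, whatever the value \<open>g 0\<close>.\<close>
definition QM_measure :: "nat \<Rightarrow> (nat \<Rightarrow> ('n + 'm) mpoly) \<Rightarrow> (real ^ 'm) measure \<Rightarrow> 'n mpoly set" where
  "QM_measure s g \<nu> =
    {\<Sum>j\<le>s. partial_integral \<nu> (\<tau> j * (if j = 0 then 1 else g j)) | \<tau>. \<forall>j\<le>s. \<tau> j \<in> sos}"

definition QM :: "'i set \<Rightarrow> ('i \<Rightarrow> 'v mpoly) \<Rightarrow> 'v mpoly set" where
  "QM J c = {\<sigma>\<^sub>0 + (\<Sum>j\<in>J. \<sigma> j * c j) | \<sigma>\<^sub>0 \<sigma>. \<sigma>\<^sub>0 \<in> sos \<and> (\<forall>j\<in>J. \<sigma> j \<in> sos)}"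

text \<open>An ideal is a submodule of the ring over itself.\<close>
definition Ideal :: "'i set \<Rightarrow> ('i \<Rightarrow> 'v mpoly) \<Rightarrow> 'v mpoly set" where
  "Ideal I c = module.span (*) (c ` I)"

definition archimedean :: "('n::finite) mpoly set \<Rightarrow> bool" where
  "archimedean M \<longleftrightarrow> (\<exists>N::int. N > 0 \<and> of_int N - (\<Sum>i\<in>UNIV. (var i)\<^sup>2) \<in> M)"

definition Riesz :: "(('n \<Rightarrow>\<^sub>0 nat) \<Rightarrow> real) \<Rightarrow> 'n mpoly \<Rightarrow> real" where
  "Riesz z p = (\<Sum>\<alpha>\<in>Poly_Mapping.keys p. Poly_Mapping.lookup p \<alpha> * z \<alpha>)"

end

theory Submission
  imports Defs
begin

text \<open>Every point \<open>x\<close> of \<open>X \<inter> K\<close> gives a feasible \<open>z\<close>, namely its sequence of monomial values, with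
\<open>\<R>\<^sub>z(f) = f(x)\<close>; this uses only that \<open>\<nu>\<close>-almost every \<open>y\<close> lies in the support \<open>Q\<close>. The content of the
theorem is the opposite inequality: if \<open>f > l\<close> on \<open>X \<inter> K\<close>, then \<open>f - l\<close> belongs to the module
\<open>M = QM[g,\<nu>] + Ideal[c\<^sub>e\<^sub>q] + QM[c\<^sub>i\<^sub>n]\<close>, so that \<open>\<R>\<^sub>z(f) \<ge> l\<close> for every feasible \<open>z\<close>. If \<open>X \<inter> K\<close> is empty,
this holds for all \<open>l\<close>, and the relaxation is infeasible as well.

Since \<open>\<sigma>(x) \<integral> p(x,y) d\<nu>(y) = \<integral> \<sigma>(x) p(x,y) d\<nu>(y)\<close>, the set \<open>M\<close> is a quadratic module of \<open>\<real>[x]\<close>, and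
it is archimedean by assumption. The Positivstellensatz of Putinar and Jacobi
(\<open>archimedean_positivstellensatz\<close>) puts into \<open>M\<close> every polynomial that is positive at all points where
\<open>M\<close> is nonnegative. Its proof here is algebraic. If \<open>-1 \<notin> M - \<Sigma>\<^sup>2 f\<close>, extend \<open>M - \<Sigma>\<^sup>2 f\<close> to a maximal
proper quadratic module; this is a total semiordering, and Dedekind cuts in it define a ring
homomorphism to \<open>\<real>\<close>, that is, a point where \<open>M\<close> is nonnegative and \<open>f \<le> 0\<close>. Otherwise \<open>t f \<in> 1 + M\<close> for
some sum of squares \<open>t\<close>, and an identity of Woermann turns this into \<open>f \<in> M\<close>.

It remains to see that a point \<open>x\<close> where \<open>M\<close> is nonnegative lies in \<open>X \<inter> K\<close>. Membership in \<open>X\<close> is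
immediate. For \<open>K\<close>, put \<open>h(y) = g\<^sub>j(x,y)\<close>; then \<open>\<integral> q\<^sup>2 h d\<nu> \<ge> 0\<close> for all polynomials \<open>q\<close>, and \<open>h \<ge> 0\<close> is
wanted on the support of \<open>\<nu>\<close> (\<open>localized_nonneg_imp_nonneg_on_support\<close>). If \<open>h\<close> were negative near a point
\<open>y\<^sub>0\<close> of the support, a bump function \<open>u\<close> at \<open>y\<^sub>0\<close> would give \<open>\<integral> u\<^sup>2 h d\<nu> < 0\<close>, so it suffices to
approximate \<open>u\<close> by polynomials in \<open>L\<^sup>2(|h| d\<nu>)\<close>. Call a bounded function a multiplier if multiplication
by it maps polynomials into the \<open>L\<^sup>2\<close>-closure of the polynomials. Multipliers form an algebra that is
closed under bounded pointwise limits. It contains \<open>sin(t y\<^sub>j)\<close>: the distances of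
\<open>y\<^sub>j\<^sup>n sin(t y\<^sub>j + n \<pi>/2) p\<close> from the polynomials vanish at \<open>t = 0\<close> and satisfy the Taylor estimates of a
function in a quasi-analytic class, so Bang's argument for the Denjoy-Carleman theorem
(\<open>bang_vanishing\<close>) makes them vanish for all \<open>t \<ge> 0\<close>. Carleman's condition on the moments of \<open>\<nu>\<close> is what
makes this class quasi-analytic. Since \<open>n sin(y\<^sub>j / n)\<close> tends to \<open>y\<^sub>j\<close>, every bounded continuous
function of one coordinate is then a multiplier, and products of such functions provide the bumps.\<close>

section \<open>Sums of squares and quadratic modules\<close>

abbreviation const :: "real \<Rightarrow> 'v mpoly" where
  "const \<equiv> Poly_Mapping.single 0"

lemma const_add: "const (a + b) = const a + const b"
  by (simp add: single_add)

lemma const_mult: "const (a * b) = const a * const b"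
  by (simp add: mult_single)

lemma const_diff: "const (a - b) = const a - const b"
  by (simp add: single_diff)

lemma const_power2: "const (a\<^sup>2) = (const a)\<^sup>2"
  by (simp add: power2_eq_square const_mult)

lemma sos_zero: "0 \<in> sos"
  unfolding sos_def by (auto intro!: exI[of _ "0::nat"])

lemma sos_add_square: "t \<in> sos \<Longrightarrow> t + a\<^sup>2 \<in> sos"
proof -
  assume "t \<in> sos"
  then obtain k :: nat and q where t: "t = (\<Sum>i<k. (q i)\<^sup>2)" unfolding sos_def by auto
  have "t + a\<^sup>2 = (\<Sum>i<Suc k. ((q(k := a)) i)\<^sup>2)" unfolding t by simp
  then show ?thesis unfolding sos_def by blast
qed

lemma sos_induct [consumes 1, case_names zero add]:
  assumes "t \<in> sos" and "P 0" and "\<And>t a. t \<in> sos \<Longrightarrow> P t \<Longrightarrow> P (t + a\<^sup>2)"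
  shows "P t"
proof -
  obtain k :: nat and q where t: "t = (\<Sum>i<k. (q i)\<^sup>2)" using assms(1) unfolding sos_def by auto
  have "(\<Sum>i<k. (q i)\<^sup>2) \<in> sos \<and> P (\<Sum>i<k. (q i)\<^sup>2)"
    by (induction k) (auto simp: assms sos_zero sos_add_square)
  then show ?thesis using t by simp
qed

lemma sos_square: "a\<^sup>2 \<in> sos"
  using sos_add_square[OF sos_zero, of a] by simp

lemma sos_one: "1 \<in> sos"
  using sos_square[of 1] by simp

lemma sos_add:
  assumes "s \<in> sos" "t \<in> sos"
  shows "s + t \<in> sos"
  using assms(2,1) by (induction t rule: sos_induct) (simp_all add: sos_add_square add.assoc[symmetric])

lemma sos_square_mult: "t \<in> sos \<Longrightarrow> a\<^sup>2 * t \<in> sos"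
proof (induction t rule: sos_induct)
  case (add t b)
  have "a\<^sup>2 * (t + b\<^sup>2) = a\<^sup>2 * t + (a * b)\<^sup>2" by (simp add: algebra_simps power2_eq_square)
  then show ?case using add sos_add_square by metis
qed (simp add: sos_zero)

definition quadratic_module :: "'v mpoly set \<Rightarrow> bool" where
  "quadratic_module M \<longleftrightarrow>
    1 \<in> M \<and> (\<forall>a\<in>M. \<forall>b\<in>M. a + b \<in> M) \<and> (\<forall>a. \<forall>b\<in>M. a\<^sup>2 * b \<in> M)"

lemma qm_one: "quadratic_module M \<Longrightarrow> 1 \<in> M"
  and qm_add: "quadratic_module M \<Longrightarrow> a \<in> M \<Longrightarrow> b \<in> M \<Longrightarrow> a + b \<in> M"
  and qm_square_mult: "quadratic_module M \<Longrightarrow> b \<in> M \<Longrightarrow> a\<^sup>2 * b \<in> M"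
  by (auto simp: quadratic_module_def)

lemma qm_square: "quadratic_module M \<Longrightarrow> a\<^sup>2 \<in> M"
  using qm_square_mult[OF _ qm_one, of M a] by simp

lemma qm_zero: "quadratic_module M \<Longrightarrow> 0 \<in> M"
  using qm_square[of M 0] by simp

lemma qm_sos_mult:
  assumes "quadratic_module M" "t \<in> sos" "p \<in> M"
  shows "t * p \<in> M"
  using assms(2,1,3)
proof (induction t rule: sos_induct)
  case (add t a)
  then show ?case by (simp add: distrib_right qm_add qm_square_mult)
qed (simp add: qm_zero)

lemma qm_sos: "quadratic_module M \<Longrightarrow> t \<in> sos \<Longrightarrow> t \<in> M"
  using qm_sos_mult[OF _ _ qm_one, of M t] by simp

lemma const_sos: "r \<ge> 0 \<Longrightarrow> const r \<in> sos"
  using sos_square[of "const (sqrt r)"] by (simp add: const_power2[symmetric])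

lemma qm_const_mult: "quadratic_module M \<Longrightarrow> r \<ge> 0 \<Longrightarrow> p \<in> M \<Longrightarrow> const r * p \<in> M"
  by (rule qm_sos_mult) (simp_all add: const_sos)

lemma qm_const: "quadratic_module M \<Longrightarrow> r \<ge> 0 \<Longrightarrow> const r \<in> M"
  by (simp add: qm_sos const_sos)

lemma qm_const_cancel:
  assumes "quadratic_module M" "r > 0" "const r * p \<in> M"
  shows "p \<in> M"
proof -
  have "const (1/r) * (const r * p) = const ((1/r) * r) * p"
    by (simp only: const_mult mult.assoc)
  then have "p = const (1/r) * (const r * p)" using assms(2) by simp
  then show ?thesis using qm_const_mult[OF assms(1) _ assms(3), of "1/r"] assms(2)
    by (metis divide_nonneg_pos zero_le_one)
qed

text \<open>The strong form of the archimedean property, in which \<open>1\<close> is an order unit for \<open>M\<close>. In a polynomial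
ring it follows from a bound on the sum of the squared variables
(\<open>archimedean_imp_order_unit_module\<close> below).\<close>
definition order_unit_module :: "'v mpoly set \<Rightarrow> bool" where
  "order_unit_module M \<longleftrightarrow> quadratic_module M \<and> (\<forall>a. \<exists>r. const r - a \<in> M)"

lemma qm_const_minus_mono:
  assumes "quadratic_module M" "const r - a \<in> M" "r \<le> r'"
  shows "const r' - a \<in> M"
proof -
  have "const r' - a = const (r' - r) + (const r - a)" by (simp add: const_diff)
  then show ?thesis using qm_add[OF assms(1) qm_const[OF assms(1)] assms(2), of "r' - r"] assms(3)
    by (metis diff_ge_0_iff_ge)
qed

lemma order_unit_module_positive:
  assumes "order_unit_module M"
  obtains r where "r > 0" "const r - a \<in> M"
proof -
  obtain r where r: "const r - a \<in> M" using assms order_unit_module_def by blast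
  have "const (max r 1) - a \<in> M" using qm_const_minus_mono[OF _ r] assms by (simp add: order_unit_module_def)
  then show ?thesis using that[of "max r 1"] by simp
qed

section \<open>The archimedean Positivstellensatz\<close>

lemma maximal_proper_quadratic_module:
  assumes "quadratic_module M" "-1 \<notin> M"
  obtains Q where "quadratic_module Q" "-1 \<notin> Q" "M \<subseteq> Q"
    "\<And>Q'. quadratic_module Q' \<Longrightarrow> -1 \<notin> Q' \<Longrightarrow> Q \<subseteq> Q' \<Longrightarrow> Q' = Q"
proof -
  let ?A = "{Q. quadratic_module Q \<and> -1 \<notin> Q \<and> M \<subseteq> Q}"
  have "\<exists>U\<in>?A. \<forall>X\<in>Ch. X \<subseteq> U" if Ch: "subset.chain ?A Ch" for Ch
  proof (cases "Ch = {}")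
    case True
    then show ?thesis using assms by auto
  next
    case False
    have in_A: "\<And>X. X \<in> Ch \<Longrightarrow> X \<in> ?A" using Ch by (auto simp: subset.chain_def)
    have lin: "\<And>X Y. X \<in> Ch \<Longrightarrow> Y \<in> Ch \<Longrightarrow> X \<subseteq> Y \<or> Y \<subseteq> X"
      using Ch by (auto simp: subset.chain_def)
    have add: "a + b \<in> \<Union>Ch" if ab: "a \<in> \<Union>Ch" "b \<in> \<Union>Ch" for a b
    proof -
      obtain X Y where "X \<in> Ch" "a \<in> X" "Y \<in> Ch" "b \<in> Y" using ab by auto
      then obtain Z where "Z \<in> Ch" "a \<in> Z" "b \<in> Z" using lin[of X Y] by blast
      then show ?thesis using in_A[of Z] qm_add[of Z a b] by auto
    qed
    have "quadratic_module (\<Union>Ch)"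
      unfolding quadratic_module_def
    proof (intro conjI ballI allI)
      show "1 \<in> \<Union>Ch" using False in_A qm_one by blast
      show "a\<^sup>2 * b \<in> \<Union>Ch" if "b \<in> \<Union>Ch" for a b using that in_A qm_square_mult by blast
    qed (rule add)
    then show ?thesis using False in_A by (intro bexI[of _ "\<Union>Ch"]) auto
  qed
  from subset_Zorn[OF this] obtain Q where Q: "Q \<in> ?A" and max: "\<forall>X\<in>?A. Q \<subseteq> X \<longrightarrow> X = Q"
    by blast
  show ?thesis
  proof (rule that[of Q])
    show "Q' = Q" if "quadratic_module Q'" "-1 \<notin> Q'" "Q \<subseteq> Q'" for Q'
      using Q max that by blast
  qed (use Q in auto)
qed

definition qm_adjoin :: "'v mpoly set \<Rightarrow> 'v mpoly \<Rightarrow> 'v mpoly set" where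
  "qm_adjoin M a = {q + t * a | q t. q \<in> M \<and> t \<in> sos}"

lemma quadratic_module_adjoin:
  assumes M: "quadratic_module M"
  shows "quadratic_module (qm_adjoin M a)" "M \<subseteq> qm_adjoin M a" "a \<in> qm_adjoin M a"
proof -
  show sub: "M \<subseteq> qm_adjoin M a"
    unfolding qm_adjoin_def using sos_zero by force
  show "a \<in> qm_adjoin M a"
    unfolding qm_adjoin_def using sos_one qm_zero[OF M] by force
  show "quadratic_module (qm_adjoin M a)"
    unfolding quadratic_module_def
  proof (intro conjI ballI allI)
    show "1 \<in> qm_adjoin M a" using sub qm_one[OF M] by blast
  next
    fix x y assume "x \<in> qm_adjoin M a" "y \<in> qm_adjoin M a"
    then obtain q t q' t' where "x = q + t * a" "q \<in> M" "t \<in> sos" "y = q' + t' * a" "q' \<in> M" "t' \<in> sos"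
      unfolding qm_adjoin_def by blast
    then have "x + y = (q + q') + (t + t') * a" "q + q' \<in> M" "t + t' \<in> sos"
      by (simp_all add: algebra_simps qm_add[OF M] sos_add)
    then show "x + y \<in> qm_adjoin M a" unfolding qm_adjoin_def by blast
  next
    fix b x assume "x \<in> qm_adjoin M a"
    then obtain q t where "x = q + t * a" "q \<in> M" "t \<in> sos" unfolding qm_adjoin_def by blast
    then have "b\<^sup>2 * x = b\<^sup>2 * q + (b\<^sup>2 * t) * a" "b\<^sup>2 * q \<in> M" "b\<^sup>2 * t \<in> sos"
      using qm_square_mult[OF M] sos_square_mult by (simp_all add: distrib_left mult.assoc)
    then show "b\<^sup>2 * x \<in> qm_adjoin M a" unfolding qm_adjoin_def by blast
  qed
qed

text \<open>The support \<open>M \<inter> -M\<close> is an ideal, because \<open>r = ((r + 1)/2)\<^sup>2 - ((r - 1)/2)\<^sup>2\<close> is a difference of two squares.\<close>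
lemma qm_support_ideal:
  assumes M: "quadratic_module M" and "a \<in> M" "-a \<in> M"
  shows "r * a \<in> M"
proof -
  have *: "const (1/2) + const (1/2) = (1 :: 'a mpoly)"
    by (simp add: single_add[symmetric])
  let ?h = "const (1/2) :: 'a mpoly"
  have "4 * ?h\<^sup>2 = (?h + ?h)\<^sup>2" by (simp add: power2_eq_square algebra_simps)
  then have h: "4 * ?h\<^sup>2 = 1" using * by simp
  have "(?h * (r + 1))\<^sup>2 * a + (?h * (r - 1))\<^sup>2 * (- a) = (4 * ?h\<^sup>2) * r * a"
    by (simp add: power2_eq_square algebra_simps)
  also have "\<dots> = r * a" using h by simp
  finally show ?thesis
    using qm_add[OF M qm_square_mult[OF M assms(2)] qm_square_mult[OF M assms(3)]] by metis
qed

text \<open>If neither \<open>a\<close> nor \<open>-a\<close> belonged to \<open>Q\<close>, maximality would give \<open>-1 = q + t a\<close> and \<open>-1 = q' - t' a\<close>.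
Eliminating \<open>a\<close> puts \<open>t'\<close> into the support of \<open>Q\<close>. The support is an ideal, so it also contains \<open>t' a\<close>, and
the second equation then shows \<open>-1 \<in> Q\<close>.\<close>
lemma maximal_quadratic_module_total:
  assumes Q: "quadratic_module Q" and proper: "-1 \<notin> Q"
    and max: "\<And>Q'. quadratic_module Q' \<Longrightarrow> -1 \<notin> Q' \<Longrightarrow> Q \<subseteq> Q' \<Longrightarrow> Q' = Q"
  shows "a \<in> Q \<or> -a \<in> Q"
proof (rule ccontr)
  assume not: "\<not> (a \<in> Q \<or> -a \<in> Q)"
  have ex: "\<exists>q t. q \<in> Q \<and> t \<in> sos \<and> -1 = q + t * b" if "b \<notin> Q" for b
  proof -
    have "-1 \<in> qm_adjoin Q b"
      using max[of "qm_adjoin Q b"] quadratic_module_adjoin[OF Q, of b] that by blast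
    then show ?thesis unfolding qm_adjoin_def by blast
  qed
  obtain q t where q: "q \<in> Q" "t \<in> sos" "-1 = q + t * a" using ex not by blast
  obtain q' t' where q': "q' \<in> Q" "t' \<in> sos" "-1 = q' + t' * (-a)" using ex not by blast
  have 1: "t * a = -1 - q" using q(3) by (metis add_diff_cancel_left')
  have 2: "t' * a = 1 + q'" using q'(3) by (simp add: algebra_simps)
  have "t' * (t * a) = t * (t' * a)" by (simp add: algebra_simps)
  then have "t' * (-1 - q) = t * (1 + q')" unfolding 1 2 .
  then have "- t' = t + t * q' + t' * q" by (simp add: algebra_simps)
  moreover have "t + t * q' + t' * q \<in> Q"
    by (rule qm_add[OF Q qm_add[OF Q qm_sos[OF Q q(2)] qm_sos_mult[OF Q q(2) q'(1)]]
          qm_sos_mult[OF Q q'(2) q(1)]])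
  ultimately have mt: "-t' \<in> Q" by simp
  have t': "t' \<in> Q" using qm_sos[OF Q q'(2)] .
  have "(-a) * t' \<in> Q" using qm_support_ideal[OF Q t' mt] .
  then have "q' + (-a) * t' \<in> Q" by (intro qm_add[OF Q q'(1)])
  then show False using q'(3) proper by (simp add: mult.commute)
qed

text \<open>For an ordering this would be the product \<open>(c - a)(c + a)\<close> of nonnegative elements. A quadratic module
need not be closed under products; the identity
\<open>2c (c\<^sup>2 - a\<^sup>2) = (c + a)\<^sup>2 (c - a) + (c - a)\<^sup>2 (c + a)\<close> uses only multiplication by squares.\<close>
lemma qm_square_bound:
  assumes Q: "quadratic_module Q" and "c > 0" and a: "const c - a \<in> Q" "const c + a \<in> Q"
  shows "const (c\<^sup>2) - a\<^sup>2 \<in> Q"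
proof -
  let ?c = "const c"
  have two: "const (2 * c) = ?c + ?c" by (simp add: single_add[symmetric])
  have "const (2 * c) * (const (c\<^sup>2) - a\<^sup>2) = (?c + a)\<^sup>2 * (?c - a) + (?c - a)\<^sup>2 * (?c + a)"
    unfolding const_power2 two by (simp add: power2_eq_square algebra_simps)
  also have "\<dots> \<in> Q"
    by (rule qm_add[OF Q qm_square_mult[OF Q a(1)] qm_square_mult[OF Q a(2)]])
  finally show ?thesis using qm_const_cancel[OF Q, of "2 * c"] assms(2) by simp
qed

definition real_hom :: "('v mpoly \<Rightarrow> real) \<Rightarrow> bool" where
  "real_hom \<alpha> \<longleftrightarrow> (\<forall>r. \<alpha> (const r) = r) \<and>
     (\<forall>a b. \<alpha> (a + b) = \<alpha> a + \<alpha> b) \<and> (\<forall>a b. \<alpha> (a * b) = \<alpha> a * \<alpha> b)"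

text \<open>The homomorphism sends \<open>a\<close> to its Dedekind cut \<open>Sup {r. a - r \<in> Q}\<close>. Linearity follows from the order-unit
property. For multiplicativity it is enough, by polarization and a shift by a constant, that
\<open>\<alpha>(a) = 0\<close> implies \<open>\<alpha>(a\<^sup>2) = 0\<close>, which is \<open>qm_square_bound\<close> with small \<open>c\<close>.\<close>
lemma total_order_unit_module_hom:
  fixes Q :: "'v mpoly set"
  assumes arch: "order_unit_module Q" and proper: "-1 \<notin> Q"
    and total: "\<And>a. a \<in> Q \<or> -a \<in> Q"
  obtains \<alpha> where "real_hom \<alpha>" "\<And>a. a \<in> Q \<Longrightarrow> \<alpha> a \<ge> 0"
proof -
  have Q: "quadratic_module Q" using arch order_unit_module_def by blast
  have neg: "r \<ge> 0" if "const r \<in> Q" for r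
  proof (rule ccontr)
    assume "\<not> r \<ge> 0"
    then have "const (1 / (-r)) * const r \<in> Q" using qm_const_mult[OF Q _ that] by simp
    moreover have "const (1 / (-r)) * const r = (-1 :: 'v mpoly)"
      using \<open>\<not> r \<ge> 0\<close> by (simp add: const_mult[symmetric] single_uminus)
    ultimately show False using proper by simp
  qed
  define \<alpha> where "\<alpha> a = Sup {r. a - const r \<in> Q}" for a
  have below: "r \<le> r'" if "a - const r \<in> Q" "const r' - a \<in> Q" for a r r'
  proof -
    have "const (r' - r) \<in> Q" using qm_add[OF Q that] by (simp add: const_diff)
    then show ?thesis using neg by fastforce
  qed
  have ne: "{r. a - const r \<in> Q} \<noteq> {}" and bdd: "bdd_above {r. a - const r \<in> Q}" for a
  proof -
    obtain r where "const r - (-a) \<in> Q" using arch order_unit_module_def by blast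
    then have "a - const (-r) \<in> Q" by (simp add: single_uminus add.commute)
    then show "{r. a - const r \<in> Q} \<noteq> {}" by blast
    obtain r' where "const r' - a \<in> Q" using arch order_unit_module_def by blast
    then show "bdd_above {r. a - const r \<in> Q}" using below[of a _ r'] by (auto intro!: bdd_aboveI[of _ r'])
  qed
  have lower: "a - const r \<in> Q" if "r < \<alpha> a" for a r
  proof -
    have "r < Sup {r. a - const r \<in> Q}" using that by (simp add: \<alpha>_def)
    then obtain r' where r': "a - const r' \<in> Q" "r < r'"
      unfolding less_cSup_iff[OF ne bdd] by blast
    have "a - const r = const (r' - r) + (a - const r')" by (simp add: const_diff)
    moreover have "const (r' - r) + (a - const r') \<in> Q"
      by (rule qm_add[OF Q qm_const[OF Q] r'(1)]) (use r'(2) in simp)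
    ultimately show ?thesis by (simp only:)
  qed
  have upper: "const r - a \<in> Q" if "r > \<alpha> a" for a r
  proof -
    have "a - const r \<notin> Q" using cSup_upper[OF _ bdd, of r a] that unfolding \<alpha>_def by force
    then show ?thesis using total[of "a - const r"] by simp
  qed
  have eqI: "\<alpha> a = v" if up: "\<And>e. e > 0 \<Longrightarrow> const (v + e) - a \<in> Q"
    and lo: "\<And>e. e > 0 \<Longrightarrow> a - const (v - e) \<in> Q" for a v
  proof (rule antisym)
    show "\<alpha> a \<le> v"
    proof (rule field_le_epsilon)
      fix e :: real assume "e > 0"
      have "\<alpha> a - e/2 \<le> v + e/2"
        using \<open>e > 0\<close> by (intro below[of a] up lower) auto
      then show "\<alpha> a \<le> v + e" by simp
    qed
    show "v \<le> \<alpha> a"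
    proof (rule field_le_epsilon)
      fix e :: real assume "e > 0"
      have "v - e/2 \<le> \<alpha> a + e/2"
        using \<open>e > 0\<close> by (intro below[of a] lo upper) auto
      then show "v \<le> \<alpha> a + e" by simp
    qed
  qed
  have const: "\<alpha> (const r) = r" for r
  proof (rule eqI)
    fix e :: real assume e: "e > 0"
    show "const (r + e) - const r \<in> Q" using qm_const[OF Q, of e] e by (simp add: const_diff[symmetric])
    show "const r - const (r - e) \<in> Q" using qm_const[OF Q, of e] e by (simp add: const_diff[symmetric])
  qed
  have add: "\<alpha> (a + b) = \<alpha> a + \<alpha> b" for a b
  proof (rule eqI)
    fix e :: real assume e: "e > 0"
    have "\<alpha> a + \<alpha> b + e = (\<alpha> a + e/2) + (\<alpha> b + e/2)" by simp
    then have 1: "const (\<alpha> a + \<alpha> b + e) - (a + b) = (const (\<alpha> a + e/2) - a) + (const (\<alpha> b + e/2) - b)"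
      by (simp only: const_add) (simp add: algebra_simps)
    then show "const (\<alpha> a + \<alpha> b + e) - (a + b) \<in> Q"
      unfolding 1 using e by (intro qm_add[OF Q] upper) auto
    have "\<alpha> a + \<alpha> b - e = (\<alpha> a - e/2) + (\<alpha> b - e/2)" by simp
    then have 2: "(a + b) - const (\<alpha> a + \<alpha> b - e) = (a - const (\<alpha> a - e/2)) + (b - const (\<alpha> b - e/2))"
      by (simp only: const_add) (simp add: algebra_simps)
    then show "(a + b) - const (\<alpha> a + \<alpha> b - e) \<in> Q"
      unfolding 2 using e by (intro qm_add[OF Q] lower) auto
  qed
  have scale: "\<alpha> (const r * a) = r * \<alpha> a" if "r > 0" for r a
  proof (rule eqI)
    fix e :: real assume e: "e > 0"
    have "r * \<alpha> a + e = r * (\<alpha> a + e/r)" using that by (simp add: field_simps)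
    then have 1: "const (r * \<alpha> a + e) - const r * a = const r * (const (\<alpha> a + e/r) - a)"
      by (simp only: const_mult) (simp add: algebra_simps)
    then show "const (r * \<alpha> a + e) - const r * a \<in> Q"
      unfolding 1 using e that by (intro qm_const_mult[OF Q] upper) auto
    have "r * \<alpha> a - e = r * (\<alpha> a - e/r)" using that by (simp add: field_simps)
    then have 2: "const r * a - const (r * \<alpha> a - e) = const r * (a - const (\<alpha> a - e/r))"
      by (simp only: const_mult) (simp add: algebra_simps)
    then show "const r * a - const (r * \<alpha> a - e) \<in> Q"
      unfolding 2 using e that by (intro qm_const_mult[OF Q] lower) auto
  qed
  have uminus: "\<alpha> (-a) = - \<alpha> a" for a
    using add[of a "-a"] const[of 0] by simp
  have scale': "\<alpha> (const r * a) = r * \<alpha> a" for r a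
  proof (cases r "0::real" rule: linorder_cases)
    case less
    have "const r * a = - (const (-r) * a)" by (simp add: single_uminus)
    then show ?thesis using scale[of "-r" a] uminus less by simp
  next
    case equal
    then show ?thesis using const[of 0] by simp
  qed (rule scale)
  have square0: "\<alpha> (a\<^sup>2) = 0" if "\<alpha> a = 0" for a
  proof (rule eqI)
    fix e :: real assume e: "e > 0"
    have "const (sqrt e) - a \<in> Q" using e that by (intro upper) auto
    moreover have "const (sqrt e) + a \<in> Q"
      using lower[of "- sqrt e" a] e that by (simp add: single_uminus add.commute)
    ultimately have "const ((sqrt e)\<^sup>2) - a\<^sup>2 \<in> Q" using e by (intro qm_square_bound[OF Q]) auto
    then show "const (0 + e) - a\<^sup>2 \<in> Q" using e by simp
    have "a\<^sup>2 + const e \<in> Q" using e by (intro qm_add[OF Q] qm_square[OF Q] qm_const[OF Q]) auto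
    then show "a\<^sup>2 - const (0 - e) \<in> Q" by (simp add: single_uminus)
  qed
  have square: "\<alpha> (a\<^sup>2) = (\<alpha> a)\<^sup>2" for a
  proof -
    let ?b = "a - const (\<alpha> a)"
    have "\<alpha> ?b = 0" using add[of ?b "const (\<alpha> a)"] const by simp
    then have "\<alpha> (?b\<^sup>2) = 0" by (rule square0)
    moreover have "a\<^sup>2 = ?b\<^sup>2 + const (2 * \<alpha> a) * ?b + const ((\<alpha> a)\<^sup>2)"
    proof -
      have two: "const (2 * \<alpha> a) = const (\<alpha> a) + const (\<alpha> a)" by (simp add: single_add[symmetric])
      show ?thesis unfolding const_power2 two by (simp add: power2_eq_square algebra_simps)
    qed
    ultimately show ?thesis using \<open>\<alpha> ?b = 0\<close> by (simp add: add scale' const)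
  qed
  have mult: "\<alpha> (a * b) = \<alpha> a * \<alpha> b" for a b
  proof -
    have "(a + b)\<^sup>2 = a\<^sup>2 + (const 2 * (a * b)) + b\<^sup>2"
    proof -
      have "const 2 = (1 + 1 :: 'v mpoly)" by (simp add: single_numeral)
      then show ?thesis by (simp add: power2_eq_square algebra_simps)
    qed
    then have "(\<alpha> a + \<alpha> b)\<^sup>2 = (\<alpha> a)\<^sup>2 + 2 * \<alpha> (a * b) + (\<alpha> b)\<^sup>2"
      by (metis add square scale')
    then show ?thesis by (simp add: power2_eq_square algebra_simps)
  qed
  have "\<alpha> a \<ge> 0" if "a \<in> Q" for a
    unfolding \<alpha>_def using that by (intro cSup_upper bdd) simp
  moreover have "real_hom \<alpha>" unfolding real_hom_def using const add mult by blast
  ultimately show ?thesis by (rule that[rotated])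
qed

lemma proper_order_unit_module_hom:
  assumes arch: "order_unit_module M" and "-1 \<notin> M"
  obtains \<alpha> where "real_hom \<alpha>" "\<And>a. a \<in> M \<Longrightarrow> \<alpha> a \<ge> 0"
proof -
  have M: "quadratic_module M" using arch order_unit_module_def by blast
  obtain Q where Q: "quadratic_module Q" "-1 \<notin> Q" "M \<subseteq> Q"
    and max: "\<And>Q'. quadratic_module Q' \<Longrightarrow> -1 \<notin> Q' \<Longrightarrow> Q \<subseteq> Q' \<Longrightarrow> Q' = Q"
    using maximal_proper_quadratic_module[OF M assms(2)] by blast
  have "order_unit_module Q" using arch Q unfolding order_unit_module_def by blast
  then show ?thesis
    using total_order_unit_module_hom[of Q] Q maximal_quadratic_module_total[OF Q(1,2) max] that
    by (metis subsetD)
qed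

text \<open>The step of Woermann's argument. If \<open>k\<close> is large enough for \<open>2k - s\<close> and \<open>2k - s\<^sup>2 f - 1\<close> to lie in \<open>M\<close>,
then each summand on the left of
\<open>(k - s)\<^sup>2 (f + r) + 2k (s f - 1) + r s (2k - s) + (2k - s\<^sup>2 f - 1) = k\<^sup>2 (f + r) - 1\<close> does too, as long as
\<open>r \<ge> 0\<close>. Hence \<open>r\<close> can be lowered by \<open>1/k\<^sup>2\<close>, an amount that does not depend on \<open>r\<close>.\<close>
lemma order_unit_lower_shift:
  assumes arch: "order_unit_module M" and s: "s \<in> sos" and sf: "s * f - 1 \<in> M"
  obtains d where "d > 0" "\<And>r. r \<ge> 0 \<Longrightarrow> f + const r \<in> M \<Longrightarrow> f + const (r - d) \<in> M"
proof -
  have M: "quadratic_module M" using arch order_unit_module_def by blast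
  obtain k1 where k1: "k1 > 0" "const k1 - s \<in> M" using order_unit_module_positive[OF arch] by blast
  obtain k2 where k2: "k2 > 0" "const k2 - (s\<^sup>2 * f + 1) \<in> M" using order_unit_module_positive[OF arch] by blast
  define k where "k = max k1 k2"
  have k: "k > 0" "k1 \<le> 2 * k" "k2 \<le> 2 * k" using k1 k2 by (auto simp: k_def)
  have b1: "const (2*k) - s \<in> M" using qm_const_minus_mono[OF M k1(2) k(2)] .
  have b2: "const (2*k) - (s\<^sup>2 * f + 1) \<in> M" using qm_const_minus_mono[OF M k2(2) k(3)] .
  have "f + const (r - 1/k\<^sup>2) \<in> M" if r: "r \<ge> 0" "f + const r \<in> M" for r
  proof -
    let ?k = "const k" and ?r = "const r"
    have two: "const (2*k) = ?k + ?k" by (simp add: single_add[symmetric])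
    have "(?k - s)\<^sup>2 * (f + ?r) + const (2*k) * (s * f - 1) + ?r * (s * (const (2*k) - s))
        + (const (2*k) - (s\<^sup>2 * f + 1)) = ?k\<^sup>2 * (f + ?r) - 1"
      unfolding two by (simp add: power2_eq_square algebra_simps)
    moreover have "(?k - s)\<^sup>2 * (f + ?r) + const (2*k) * (s * f - 1) + ?r * (s * (const (2*k) - s))
        + (const (2*k) - (s\<^sup>2 * f + 1)) \<in> M"
      by (rule qm_add[OF M qm_add[OF M qm_add[OF M qm_square_mult[OF M r(2)]
              qm_const_mult[OF M _ sf]] qm_const_mult[OF M r(1) qm_sos_mult[OF M s b1]]] b2])
        (use k in simp)
    moreover have "?k\<^sup>2 * (f + ?r) - 1 = const (k\<^sup>2) * (f + const (r - 1/k\<^sup>2))"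
    proof -
      have "const (k\<^sup>2) * const (1/k\<^sup>2) = 1" using k by (simp add: const_mult[symmetric])
      then show ?thesis by (simp add: const_diff const_power2[symmetric] algebra_simps)
    qed
    ultimately have "const (k\<^sup>2) * (f + const (r - 1/k\<^sup>2)) \<in> M" by simp
    then show ?thesis by (rule qm_const_cancel[OF M, rotated]) (use k in simp)
  qed
  then show ?thesis using that[of "1/k\<^sup>2"] k by simp
qed

text \<open>Some \<open>f + r\<close> lies in \<open>M\<close> because \<open>1\<close> is an order unit, and finitely many lowering steps bring \<open>r\<close> to \<open>0\<close> or below.\<close>
lemma order_unit_witness_mem:
  assumes arch: "order_unit_module M" and s: "s \<in> sos" and sf: "s * f - 1 \<in> M"
  shows "f \<in> M"
proof -
  have M: "quadratic_module M" using arch order_unit_module_def by blast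
  obtain d where d: "d > 0" "\<And>r. r \<ge> 0 \<Longrightarrow> f + const r \<in> M \<Longrightarrow> f + const (r - d) \<in> M"
    using order_unit_lower_shift[OF assms] by blast
  obtain r0 where r0: "r0 > 0" "const r0 - (-f) \<in> M"
    using order_unit_module_positive[OF arch] by blast
  have "\<exists>r\<le>max 0 (r0 - real n * d). f + const r \<in> M" for n
  proof (induction n)
    case 0
    then show ?case using r0 by (intro exI[of _ r0]) (simp add: add.commute)
  next
    case (Suc n)
    then obtain r where r: "r \<le> max 0 (r0 - real n * d)" "f + const r \<in> M" by blast
    show ?case
    proof (cases "r \<ge> 0")
      case True
      then show ?thesis using d r by (intro exI[of _ "r - d"]) (auto simp: algebra_simps)
    next
      case False
      then show ?thesis using r by (intro exI[of _ r]) auto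
    qed
  qed
  moreover obtain n where "r0 < real n * d" using reals_Archimedean3 d(1) by blast
  ultimately obtain r where r: "r \<le> 0" "f + const r \<in> M" by (metis diff_less_0_iff_less max.absorb1 order_less_imp_le)
  have "f = const (-r) + (f + const r)" by (simp add: single_uminus)
  moreover have "const (-r) + (f + const r) \<in> M"
    by (rule qm_add[OF M qm_const[OF M] r(2)]) (use r(1) in simp)
  ultimately show ?thesis by (simp only:)
qed

text \<open>The homomorphisms are the point evaluations (\<open>real_hom_eq_mpoly_eval\<close>). If adjoining \<open>-f\<close> to \<open>M\<close> left a
proper module, that module would be nonnegative at some homomorphism, and there \<open>f \<le> 0\<close>. So \<open>-1 = q - t f\<close>
with \<open>q \<in> M\<close>, which is the hypothesis of \<open>order_unit_witness_mem\<close>.\<close>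
theorem archimedean_positivstellensatz:
  assumes arch: "order_unit_module M"
    and pos: "\<And>\<alpha>. real_hom \<alpha> \<Longrightarrow> (\<And>a. a \<in> M \<Longrightarrow> \<alpha> a \<ge> 0) \<Longrightarrow> \<alpha> f > 0"
  shows "f \<in> M"
proof -
  have M: "quadratic_module M" using arch order_unit_module_def by blast
  note N = quadratic_module_adjoin[OF M, of "-f"]
  have arch': "order_unit_module (qm_adjoin M (-f))"
    using arch N unfolding order_unit_module_def by blast
  have "-1 \<in> qm_adjoin M (-f)"
  proof (rule ccontr)
    assume "-1 \<notin> qm_adjoin M (-f)"
    then obtain \<alpha> where \<alpha>: "real_hom \<alpha>" "\<And>a. a \<in> qm_adjoin M (-f) \<Longrightarrow> \<alpha> a \<ge> 0"
      using proper_order_unit_module_hom[OF arch'] by blast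
    have "\<alpha> f > 0" using pos \<alpha> N(2) by blast
    moreover have "\<alpha> (-f) \<ge> 0" using \<alpha> N(3) by blast
    moreover have "\<alpha> f + \<alpha> (-f) = 0"
      using \<alpha>(1) unfolding real_hom_def by (metis add.right_inverse single_zero)
    ultimately show False by simp
  qed
  then obtain q t where "q \<in> M" "t \<in> sos" "-1 = q + t * (-f)" unfolding qm_adjoin_def by blast
  then have "t * f - 1 = q" by (simp add: algebra_simps)
  then have "t * f - 1 \<in> M" using \<open>q \<in> M\<close> by simp
  then show ?thesis using order_unit_witness_mem[OF arch \<open>t \<in> sos\<close>] by blast
qed

section \<open>Evaluation of polynomials\<close>

lemma mpoly_induct [case_names single add]:
  assumes single: "\<And>\<alpha> r. Q (Poly_Mapping.single \<alpha> r)"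
    and add: "\<And>p q. Q p \<Longrightarrow> Q q \<Longrightarrow> Q (p + q)"
  shows "Q (p :: 'v mpoly)"
proof -
  have "Q (\<Sum>\<alpha>\<in>A. Poly_Mapping.single \<alpha> (Poly_Mapping.lookup p \<alpha>))" if "finite A" for A
    using that
  proof (induction A rule: finite_induct)
    case empty
    then show ?case using single[of 0 0] by simp
  qed (simp add: single add)
  moreover have "p = (\<Sum>\<alpha>\<in>Poly_Mapping.keys p. Poly_Mapping.single \<alpha> (Poly_Mapping.lookup p \<alpha>))"
    by (rule poly_mapping_eqI) (simp add: lookup_sum lookup_single when_def in_keys_iff)
  ultimately show ?thesis by (metis finite_keys)
qed

lemma Riesz_single [simp]: "Riesz z (Poly_Mapping.single \<alpha> r) = r * z \<alpha>"
  by (simp add: Riesz_def)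

lemma Riesz_add: "Riesz z (p + q) = Riesz z p + Riesz z q"
  unfolding Riesz_def
  by (rule setsum_keys_plus_distrib[where f = "\<lambda>\<alpha> r. r * z \<alpha>"]) (simp_all add: distrib_right)

text \<open>The Riesz functional of a multiplicative sequence is a ring homomorphism. Applied to the monomial values
at a point, this yields the ring homomorphism property of evaluation.\<close>
lemma Riesz_mult:
  assumes z: "\<And>\<alpha> \<beta>. z (\<alpha> + \<beta>) = z \<alpha> * z \<beta>"
  shows "Riesz z (p * q) = Riesz z p * Riesz z q"
proof (induction p rule: mpoly_induct)
  case (single \<alpha> r)
  show ?case
  proof (induction q rule: mpoly_induct)
    case (single \<beta> s)
    then show ?case by (simp add: mult_single z)
  qed (simp add: distrib_left Riesz_add)
qed (simp add: distrib_right Riesz_add)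

lemma mpoly_eval_eq_Riesz: "mpoly_eval a = Riesz (monom_eval a)"
  by (rule ext) (simp add: mpoly_eval_def Riesz_def)

lemma monom_eval_add: "monom_eval a (\<alpha> + \<beta>) = monom_eval a \<alpha> * monom_eval a \<beta>"
  by (simp add: monom_eval_def lookup_add power_add prod.distrib)

lemma monom_eval_zero [simp]: "monom_eval a 0 = 1"
  by (simp add: monom_eval_def)

lemma monom_eval_var: "monom_eval a (Poly_Mapping.single i 1) = a i"
proof -
  have "(\<Prod>k\<in>UNIV. a k ^ Poly_Mapping.lookup (Poly_Mapping.single i 1) k) = (\<Prod>k\<in>{i}. a k ^ Poly_Mapping.lookup (Poly_Mapping.single i 1) k)"
    by (rule prod.mono_neutral_right) (auto simp: lookup_single when_def)
  then show ?thesis by (simp add: monom_eval_def)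
qed

lemma mpoly_eval_add: "mpoly_eval a (p + q) = mpoly_eval a p + mpoly_eval a q"
  and mpoly_eval_mult: "mpoly_eval a (p * q) = mpoly_eval a p * mpoly_eval a q"
  and mpoly_eval_single: "mpoly_eval a (Poly_Mapping.single \<alpha> r) = r * monom_eval a \<alpha>"
  and mpoly_eval_var: "mpoly_eval a (var i) = a i"
  unfolding mpoly_eval_eq_Riesz var_def
  by (simp_all add: Riesz_add Riesz_mult monom_eval_add monom_eval_var del: One_nat_def)

lemma mpoly_eval_const [simp]: "mpoly_eval a (const r) = r"
  by (simp add: mpoly_eval_single)

lemma mpoly_eval_zero [simp]: "mpoly_eval a 0 = 0"
  using mpoly_eval_const[of a 0] by simp

lemma mpoly_eval_one [simp]: "mpoly_eval a 1 = 1"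
  using mpoly_eval_const[of a 1] by simp

lemma mpoly_eval_power: "mpoly_eval a (p ^ n) = mpoly_eval a p ^ n"
  by (induction n) (simp_all add: mpoly_eval_mult)

lemma mpoly_eval_sum: "mpoly_eval a (sum p A) = (\<Sum>i\<in>A. mpoly_eval a (p i))"
  by (induction A rule: infinite_finite_induct) (simp_all add: mpoly_eval_add)

lemma mpoly_eval_sos: "t \<in> sos \<Longrightarrow> mpoly_eval a t \<ge> 0"
  by (induction t rule: sos_induct) (simp_all add: mpoly_eval_add mpoly_eval_power)

lemmas poly_at_simps = poly_at_def mpoly_eval_add mpoly_eval_mult mpoly_eval_power mpoly_eval_sum

lemma single_eq_const_mult_vars:
  fixes \<alpha> :: "'v::finite \<Rightarrow>\<^sub>0 nat"
  shows "Poly_Mapping.single \<alpha> r = const r * (\<Prod>i\<in>UNIV. var i ^ Poly_Mapping.lookup \<alpha> i)"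
proof -
  have pow: "var i ^ n = Poly_Mapping.single (Poly_Mapping.single i n) 1" for i :: 'v and n
    by (induction n) (simp_all add: var_def mult_single single_add[symmetric])
  have prod: "(\<Prod>i\<in>A. Poly_Mapping.single (\<beta> i) (1::real)) = Poly_Mapping.single (\<Sum>i\<in>A. \<beta> i) 1"
    if "finite A" for A :: "'v set" and \<beta> :: "'v \<Rightarrow> 'v \<Rightarrow>\<^sub>0 nat"
    using that by (induction A rule: finite_induct) (simp_all add: mult_single)
  have "(\<Sum>i\<in>UNIV. Poly_Mapping.single i (Poly_Mapping.lookup \<alpha> i)) = \<alpha>"
    by (rule poly_mapping_eqI) (simp add: lookup_sum lookup_single when_def)
  then show ?thesis by (simp add: pow prod mult_single)
qed

lemma real_hom_eq_mpoly_eval: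
  fixes \<alpha> :: "'v::finite mpoly \<Rightarrow> real"
  assumes "real_hom \<alpha>"
  shows "\<alpha> p = mpoly_eval (\<lambda>i. \<alpha> (var i)) p"
proof -
  have const: "\<alpha> (const r) = r" and add: "\<alpha> (a + b) = \<alpha> a + \<alpha> b" and mult: "\<alpha> (a * b) = \<alpha> a * \<alpha> b" for r a b
    using assms unfolding real_hom_def by blast+
  have one: "\<alpha> 1 = 1" using const[of 1] by simp
  have pow: "\<alpha> (a ^ n) = \<alpha> a ^ n" for a n by (induction n) (simp_all add: one mult)
  have prod: "\<alpha> (prod a A) = (\<Prod>i\<in>A. \<alpha> (a i))" for a and A :: "'v set"
    by (induction A rule: infinite_finite_induct) (simp_all add: one mult)
  show ?thesis
  proof (induction p rule: mpoly_induct)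
    case (single \<beta> r)
    have "\<alpha> (Poly_Mapping.single \<beta> r) = r * (\<Prod>i\<in>UNIV. \<alpha> (var i) ^ Poly_Mapping.lookup \<beta> i)"
      by (simp only: single_eq_const_mult_vars[of \<beta>] mult const prod pow)
    then show ?case by (simp only: mpoly_eval_single monom_eval_def)
  qed (simp add: add mpoly_eval_add)
qed

section \<open>Bounded elements of an archimedean module\<close>

text \<open>Bounding squares instead of elements makes the set visibly closed under sums and products.\<close>
definition qm_bounded :: "'v mpoly set \<Rightarrow> 'v mpoly set" where
  "qm_bounded M = {a. \<exists>r\<ge>0. const r - a\<^sup>2 \<in> M}"

text \<open>Sums are bounded by the parallelogram identity \<open>2 a\<^sup>2 + 2 b\<^sup>2 - (a + b)\<^sup>2 = (a - b)\<^sup>2\<close>, products by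
\<open>r s - a\<^sup>2 b\<^sup>2 = s (r - a\<^sup>2) + a\<^sup>2 (s - b\<^sup>2)\<close>.\<close>
lemma qm_bounded_closed:
  assumes M: "quadratic_module M"
  shows "const r \<in> qm_bounded M"
    and "a \<in> qm_bounded M \<Longrightarrow> b \<in> qm_bounded M \<Longrightarrow> a + b \<in> qm_bounded M"
    and "a \<in> qm_bounded M \<Longrightarrow> b \<in> qm_bounded M \<Longrightarrow> a * b \<in> qm_bounded M"
proof -
  have "const (r\<^sup>2) - (const r)\<^sup>2 \<in> M" using qm_zero[OF M] by (simp add: const_power2)
  then show "const r \<in> qm_bounded M" unfolding qm_bounded_def using zero_le_power2 by blast
next
  assume "a \<in> qm_bounded M" "b \<in> qm_bounded M"
  then obtain r s where r: "r \<ge> 0" "const r - a\<^sup>2 \<in> M" and s: "s \<ge> 0" "const s - b\<^sup>2 \<in> M"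
    unfolding qm_bounded_def by blast
  have "const (2 * r + 2 * s) - (a + b)\<^sup>2 = const 2 * (const r - a\<^sup>2) + const 2 * (const s - b\<^sup>2) + (a - b)\<^sup>2"
  proof -
    have two: "const 2 = (1 + 1 :: 'a mpoly)" by (simp add: single_numeral)
    show ?thesis unfolding const_add const_mult two by (simp add: power2_eq_square algebra_simps)
  qed
  also have "\<dots> \<in> M"
    by (rule qm_add[OF M qm_add[OF M qm_const_mult[OF M _ r(2)] qm_const_mult[OF M _ s(2)]] qm_square[OF M]]) simp_all
  finally show "a + b \<in> qm_bounded M" unfolding qm_bounded_def
    using r(1) s(1) by (intro CollectI exI[of _ "2 * r + 2 * s"]) simp
  have "const (r * s) - (a * b)\<^sup>2 = const s * (const r - a\<^sup>2) + a\<^sup>2 * (const s - b\<^sup>2)"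
    unfolding const_mult by (simp add: power2_eq_square algebra_simps)
  also have "\<dots> \<in> M"
    by (rule qm_add[OF M qm_const_mult[OF M s(1) r(2)] qm_square_mult[OF M s(2)]])
  finally show "a * b \<in> qm_bounded M" unfolding qm_bounded_def using r(1) s(1) by (auto intro!: exI[of _ "r * s"])
qed

text \<open>The bounded elements form a subalgebra that contains the variables, hence everything, and
\<open>2a \<le> a\<^sup>2 + 1\<close> turns a bound on \<open>a\<^sup>2\<close> into one on \<open>a\<close>.\<close>
lemma archimedean_imp_order_unit_module:
  fixes M :: "'v::finite mpoly set"
  assumes M: "quadratic_module M" and arch: "archimedean M"
  shows "order_unit_module M"
proof -
  obtain N :: int where N: "N > 0" "of_int N - (\<Sum>i\<in>UNIV. (var i)\<^sup>2) \<in> M"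
    using arch unfolding archimedean_def by blast
  have var: "var i \<in> qm_bounded M" for i
  proof -
    have sum: "(\<Sum>k\<in>A. (var k)\<^sup>2) \<in> M" for A :: "'v set"
      by (induction A rule: infinite_finite_induct) (simp_all add: qm_zero[OF M] qm_add[OF M] qm_square[OF M])
    have "(\<Sum>k\<in>UNIV. (var k)\<^sup>2) = (var i)\<^sup>2 + (\<Sum>k\<in>UNIV - {i}. (var k :: 'v mpoly)\<^sup>2)"
      by (rule sum.remove) auto
    then have "const (of_int N) - (var i)\<^sup>2 = (of_int N - (\<Sum>k\<in>UNIV. (var k)\<^sup>2)) + (\<Sum>k\<in>UNIV - {i}. (var k)\<^sup>2)"
      by (simp add: algebra_simps)
    then have "const (of_int N) - (var i)\<^sup>2 \<in> M" using qm_add[OF M N(2) sum] by (simp only:)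
    then show ?thesis unfolding qm_bounded_def using N(1) by (auto intro!: exI[of _ "of_int N"])
  qed
  note closed = qm_bounded_closed[OF M]
  have pow: "a \<in> qm_bounded M \<Longrightarrow> a ^ n \<in> qm_bounded M" for a n
    using closed(1)[of 1] by (induction n) (simp_all add: closed(3))
  have prod: "(\<And>i. a i \<in> qm_bounded M) \<Longrightarrow> prod a A \<in> qm_bounded M" for a and A :: "'v set"
    using closed(1)[of 1] by (induction A rule: infinite_finite_induct) (simp_all add: closed(3))
  have all: "p \<in> qm_bounded M" for p
  proof (induction p rule: mpoly_induct)
    case (single \<alpha> r)
    show ?case unfolding single_eq_const_mult_vars[of \<alpha> r]
      by (rule closed(3)[OF closed(1) prod[OF pow[OF var]]])
  qed (rule closed(2))
  have "\<exists>r. const r - a \<in> M" for a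
  proof -
    obtain r where r: "const r - a\<^sup>2 \<in> M" using all[of a] unfolding qm_bounded_def by blast
    have one: "const (1 + r) = 1 + const r" by (simp add: const_add)
    have two: "const 2 = (1 + 1 :: 'v mpoly)" by (simp add: single_numeral)
    have half: "2 * ((1 + r) / 2) = 1 + r" by simp
    have "const 2 * (const ((1 + r) / 2) - a) = const (1 + r) - const 2 * a"
      by (simp only: right_diff_distrib const_mult[symmetric] half)
    also have "\<dots> = (const r - a\<^sup>2) + (1 - a)\<^sup>2"
      unfolding one two by (simp add: power2_eq_square algebra_simps)
    also have "\<dots> \<in> M" by (rule qm_add[OF M r qm_square[OF M]])
    finally have "const 2 * (const ((1 + r) / 2) - a) \<in> M" .
    then have "const ((1 + r) / 2) - a \<in> M" by (rule qm_const_cancel[OF M, rotated]) simp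
    then show ?thesis ..
  qed
  then show ?thesis using M unfolding order_unit_module_def by blast
qed

section \<open>Integrating out the second group of variables\<close>

lemma partial_integral_single:
  "partial_integral \<nu> (Poly_Mapping.single \<gamma> r) = Poly_Mapping.single (Poly_Mapping.map_key Inl \<gamma>)
    (r * (\<integral>y. monom_eval (\<lambda>j. y $ j) (Poly_Mapping.map_key Inr \<gamma>) \<partial>\<nu>))"
  by (simp add: partial_integral_def)

lemma partial_integral_add:
  "partial_integral \<nu> (p + q) = partial_integral \<nu> p + partial_integral \<nu> q"
  unfolding partial_integral_def
  by (rule setsum_keys_plus_distrib[where f = "\<lambda>\<gamma> r. Poly_Mapping.single (Poly_Mapping.map_key Inl \<gamma>)
    (r * (\<integral>y. monom_eval (\<lambda>j. y $ j) (Poly_Mapping.map_key Inr \<gamma>) \<partial>\<nu>))"])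
    (simp_all add: distrib_right single_add)

lemma partial_integral_zero: "partial_integral \<nu> 0 = 0"
  by (simp add: partial_integral_def)

lemma monom_eval_case_sum:
  fixes \<gamma> :: "'n::finite + 'm::finite \<Rightarrow>\<^sub>0 nat"
  shows "monom_eval (case_sum a b) \<gamma> =
    monom_eval a (Poly_Mapping.map_key Inl \<gamma>) * monom_eval b (Poly_Mapping.map_key Inr \<gamma>)"
proof -
  have lk: "Poly_Mapping.lookup (Poly_Mapping.map_key Inl \<gamma>) i = Poly_Mapping.lookup \<gamma> (Inl i)"
    "Poly_Mapping.lookup (Poly_Mapping.map_key Inr \<gamma>) j = Poly_Mapping.lookup \<gamma> (Inr j)" for i j
    by (simp_all add: map_key.rep_eq)
  show ?thesis
    unfolding monom_eval_def lk UNIV_Plus_UNIV[symmetric]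
    by (subst prod.Plus) (simp_all add: o_def)
qed

lemma integrable_poly_at2:
  fixes p :: "('n::finite + 'm::finite) mpoly"
  assumes "finite_moments \<nu>"
  shows "integrable \<nu> (\<lambda>y. poly_at2 p x y)"
  unfolding poly_at2_def
proof (induction p rule: mpoly_induct)
  case (single \<gamma> r)
  then show ?case using assms unfolding finite_moments_def
    by (simp add: mpoly_eval_single monom_eval_case_sum)
qed (simp add: mpoly_eval_add)

lemma poly_at_partial_integral:
  fixes p :: "('n::finite + 'm::finite) mpoly"
  assumes \<nu>: "finite_moments \<nu>"
  shows "poly_at (partial_integral \<nu> p) x = (\<integral>y. poly_at2 p x y \<partial>\<nu>)"
proof (induction p rule: mpoly_induct)
  case (single \<gamma> r)
  then show ?case
    by (simp add: partial_integral_single poly_at_def poly_at2_def mpoly_eval_single monom_eval_case_sum mult_ac)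
next
  case (add p q)
  have "poly_at2 (p + q) x y = poly_at2 p x y + poly_at2 q x y" for y
    by (simp add: poly_at2_def mpoly_eval_add)
  then show ?case
    using add by (simp add: partial_integral_add poly_at_simps integrable_poly_at2[OF \<nu>])
qed

text \<open>The factor \<open>A\<close> is \<open>a\<close> read as a polynomial in both groups of variables. As the property is additive
in \<open>a\<close>, the reading has to be constructed for monomials only.\<close>
lemma partial_integral_linear_over_x:
  fixes a :: "'n::finite mpoly" and \<nu> :: "(real ^ 'm::finite) measure"
  shows "\<exists>A. \<forall>p. partial_integral \<nu> (A * p) = a * partial_integral \<nu> p"
proof (induction a rule: mpoly_induct)
  case (single \<alpha> r)
  define \<alpha>' :: "'n + 'm \<Rightarrow>\<^sub>0 nat" where "\<alpha>' = Abs_poly_mapping (case_sum (Poly_Mapping.lookup \<alpha>) (\<lambda>_. 0))"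
  have "Poly_Mapping.lookup \<alpha>' = case_sum (Poly_Mapping.lookup \<alpha>) (\<lambda>_. 0)"
    unfolding \<alpha>'_def by (rule lookup_Abs_poly_mapping) simp
  then have \<alpha>': "Poly_Mapping.map_key Inl \<alpha>' = \<alpha>" "Poly_Mapping.map_key Inr \<alpha>' = 0"
    by (auto intro!: poly_mapping_eqI simp: map_key.rep_eq)
  have "partial_integral \<nu> (Poly_Mapping.single \<alpha>' r * p) = Poly_Mapping.single \<alpha> r * partial_integral \<nu> p" for p
  proof (induction p rule: mpoly_induct)
    case (single \<gamma> s)
    show ?case by (simp add: mult_single partial_integral_single map_key_plus \<alpha>' mult_ac)
  qed (simp add: distrib_left partial_integral_add)
  then show ?case by blast
next
  case (add a b)
  then obtain A B where "\<And>p. partial_integral \<nu> (A * p) = a * partial_integral \<nu> p"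
    "\<And>p. partial_integral \<nu> (B * p) = b * partial_integral \<nu> p" by blast
  then have "\<forall>p. partial_integral \<nu> ((A + B) * p) = (a + b) * partial_integral \<nu> p"
    by (simp add: distrib_right partial_integral_add)
  then show ?case by blast
qed

section \<open>The quadratic module of the relaxation\<close>

text \<open>A quadratic module except that \<open>1\<close> need not belong to it. Of the three summands of the module, only
\<open>QM J c\<close> is sure to contain \<open>1\<close>; for the zero measure, for instance, \<open>QM_measure s g \<nu> = {0}\<close>.\<close>
definition square_cone :: "'v mpoly set \<Rightarrow> bool" where
  "square_cone S \<longleftrightarrow> 0 \<in> S \<and> (\<forall>a\<in>S. \<forall>b\<in>S. a + b \<in> S) \<and> (\<forall>a. \<forall>b\<in>S. a\<^sup>2 * b \<in> S)"

lemma square_cone_plus: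
  assumes "square_cone S" "square_cone T"
  shows "square_cone (S + T)"
  unfolding square_cone_def
proof (intro conjI ballI allI)
  show "0 \<in> S + T" using assms unfolding square_cone_def by (metis add_0 set_plus_intro)
next
  fix x y assume "x \<in> S + T" "y \<in> S + T"
  then obtain a b a' b' where "x = a + b" "y = a' + b'" "a \<in> S" "a' \<in> S" "b \<in> T" "b' \<in> T"
    by (elim set_plus_elim) blast
  moreover have "(a + b) + (a' + b') = (a + a') + (b + b')" by (simp add: algebra_simps)
  ultimately show "x + y \<in> S + T" using assms unfolding square_cone_def by (metis set_plus_intro)
next
  fix a x assume "x \<in> S + T"
  then obtain s t where "x = s + t" "s \<in> S" "t \<in> T" by (rule set_plus_elim)
  then show "a\<^sup>2 * x \<in> S + T" using assms unfolding square_cone_def by (simp add: distrib_left set_plus_intro)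
qed

lemma square_cone_QM_measure:
  fixes \<nu> :: "(real ^ 'm::finite) measure" and g :: "nat \<Rightarrow> ('n::finite + 'm) mpoly"
  shows "square_cone (QM_measure s g \<nu>)"
proof -
  let ?g = "\<lambda>j. if j = 0 then 1 else g j"
  have I: "(\<Sum>j\<le>s. partial_integral \<nu> (\<tau> j * ?g j)) \<in> QM_measure s g \<nu>" if "\<And>j. \<tau> j \<in> sos" for \<tau>
    unfolding QM_measure_def using that by blast
  have E: "\<exists>\<tau>. (\<forall>j. \<tau> j \<in> sos) \<and> p = (\<Sum>j\<le>s. partial_integral \<nu> (\<tau> j * ?g j))" if p: "p \<in> QM_measure s g \<nu>" for p
  proof -
    obtain \<tau> where \<tau>: "\<forall>j\<le>s. \<tau> j \<in> sos" "p = (\<Sum>j\<le>s. partial_integral \<nu> (\<tau> j * ?g j))"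
      using p unfolding QM_measure_def by blast
    then show ?thesis
      by (intro exI[of _ "\<lambda>j. if j \<le> s then \<tau> j else 0"]) (auto simp: sos_zero intro!: sum.cong)
  qed
  show ?thesis unfolding square_cone_def
  proof (intro conjI ballI allI)
    show "0 \<in> QM_measure s g \<nu>" using I[of "\<lambda>_. 0"] by (simp add: sos_zero partial_integral_zero)
  next
    fix p q assume "p \<in> QM_measure s g \<nu>" "q \<in> QM_measure s g \<nu>"
    from this[THEN E] obtain \<tau> \<tau>' where \<tau>: "\<And>j. \<tau> j \<in> sos" "\<And>j. \<tau>' j \<in> sos"
      and eq: "p = (\<Sum>j\<le>s. partial_integral \<nu> (\<tau> j * ?g j))"
        "q = (\<Sum>j\<le>s. partial_integral \<nu> (\<tau>' j * ?g j))" by blast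
    have "p + q = (\<Sum>j\<le>s. partial_integral \<nu> ((\<tau> j + \<tau>' j) * ?g j))"
      unfolding eq distrib_right partial_integral_add sum.distrib ..
    then show "p + q \<in> QM_measure s g \<nu>" using I[of "\<lambda>j. \<tau> j + \<tau>' j", OF sos_add[OF \<tau>]]
      by (simp only:)
  next
    fix a :: "'n mpoly" and p assume "p \<in> QM_measure s g \<nu>"
    from E[OF this] obtain \<tau> where \<tau>: "\<And>j. \<tau> j \<in> sos"
      "p = (\<Sum>j\<le>s. partial_integral \<nu> (\<tau> j * ?g j))" by blast
    \<comment> \<open>pulling \<open>a\<^sup>2\<close> under the integral replaces the multiplier \<open>\<tau>\<^sub>j\<close> by the sum of squares \<open>A\<^sup>2 \<tau>\<^sub>j\<close>\<close>
    obtain A where A: "\<forall>p. partial_integral \<nu> (A * p) = a * partial_integral \<nu> p"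
      using partial_integral_linear_over_x[of \<nu> a] ..
    have "a\<^sup>2 * partial_integral \<nu> (\<tau> j * ?g j) = partial_integral \<nu> ((A\<^sup>2 * \<tau> j) * ?g j)" for j
    proof -
      have "(A\<^sup>2 * \<tau> j) * ?g j = A * (A * (\<tau> j * ?g j))" by (simp only: power2_eq_square mult.assoc)
      then have "partial_integral \<nu> ((A\<^sup>2 * \<tau> j) * ?g j) = a * (a * partial_integral \<nu> (\<tau> j * ?g j))"
        by (simp only: A[rule_format])
      then show ?thesis by (simp only: power2_eq_square mult.assoc)
    qed
    then have "a\<^sup>2 * p = (\<Sum>j\<le>s. partial_integral \<nu> ((A\<^sup>2 * \<tau> j) * ?g j))"
      unfolding \<tau>(2) sum_distrib_left by (simp only:)
    then show "a\<^sup>2 * p \<in> QM_measure s g \<nu>"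
      using I[of "\<lambda>j. A\<^sup>2 * \<tau> j", OF sos_square_mult[OF \<tau>(1)]] by (simp only:)
  qed
qed

lemma QM_measure_generator:
  fixes \<nu> :: "(real ^ 'm::finite) measure" and g :: "nat \<Rightarrow> ('n::finite + 'm) mpoly"
  assumes "j \<in> {1..s}" "t \<in> sos"
  shows "partial_integral \<nu> (t * g j) \<in> QM_measure s g \<nu>"
proof -
  let ?\<tau> = "\<lambda>i. if i = j then t else 0"
  have "(\<Sum>i\<le>s. partial_integral \<nu> (?\<tau> i * (if i = 0 then 1 else g i)))
      = (\<Sum>i\<in>{j}. partial_integral \<nu> (?\<tau> i * (if i = 0 then 1 else g i)))"
    using assms(1) by (intro sum.mono_neutral_right) (auto simp: partial_integral_zero)
  also have "\<dots> = partial_integral \<nu> (t * g j)" using assms(1) by simp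
  finally have "partial_integral \<nu> (t * g j) = (\<Sum>i\<le>s. partial_integral \<nu> (?\<tau> i * (if i = 0 then 1 else g i)))" ..
  moreover have "\<forall>i\<le>s. ?\<tau> i \<in> sos" using assms(2) sos_zero by auto
  ultimately show ?thesis unfolding QM_measure_def by (intro CollectI exI[of _ ?\<tau>] conjI)
qed

lemma Ideal_module: "module ((*) :: 'v mpoly \<Rightarrow> 'v mpoly \<Rightarrow> 'v mpoly)"
  by unfold_locales (simp_all add: algebra_simps)

lemma square_cone_Ideal: "square_cone (Ideal I c)"
  unfolding square_cone_def Ideal_def
  using module.span_zero[OF Ideal_module] module.span_add[OF Ideal_module] module.span_scale[OF Ideal_module]
  by blast

lemma square_cone_QM: "square_cone (QM J c)"
  and one_in_QM: "1 \<in> QM J c"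
proof -
  have I: "\<sigma>0 + (\<Sum>j\<in>J. \<sigma> j * c j) \<in> QM J c" if "\<sigma>0 \<in> sos" "\<And>j. j \<in> J \<Longrightarrow> \<sigma> j \<in> sos" for \<sigma>0 \<sigma>
    unfolding QM_def using that by blast
  show "1 \<in> QM J c" using I[of 1 "\<lambda>_. 0"] by (simp add: sos_one sos_zero)
  show "square_cone (QM J c)"
    unfolding square_cone_def
  proof (intro conjI ballI allI)
    show "0 \<in> QM J c" using I[of 0 "\<lambda>_. 0"] by (simp add: sos_zero)
  next
    fix p q assume "p \<in> QM J c" "q \<in> QM J c"
    then obtain \<sigma>0 \<sigma> \<tau>0 \<tau> where "\<sigma>0 \<in> sos" "\<forall>j\<in>J. \<sigma> j \<in> sos" "p = \<sigma>0 + (\<Sum>j\<in>J. \<sigma> j * c j)"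
      "\<tau>0 \<in> sos" "\<forall>j\<in>J. \<tau> j \<in> sos" "q = \<tau>0 + (\<Sum>j\<in>J. \<tau> j * c j)" unfolding QM_def by blast
    then show "p + q \<in> QM J c" using I[of "\<sigma>0 + \<tau>0" "\<lambda>j. \<sigma> j + \<tau> j"]
      by (simp add: sos_add distrib_right sum.distrib add_ac)
  next
    fix a p assume "p \<in> QM J c"
    then obtain \<sigma>0 \<sigma> where "\<sigma>0 \<in> sos" "\<forall>j\<in>J. \<sigma> j \<in> sos" "p = \<sigma>0 + (\<Sum>j\<in>J. \<sigma> j * c j)" unfolding QM_def by blast
    then show "a\<^sup>2 * p \<in> QM J c" using I[of "a\<^sup>2 * \<sigma>0" "\<lambda>j. a\<^sup>2 * \<sigma> j"]
      by (simp add: sos_square_mult distrib_left sum_distrib_left mult.assoc)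
  qed
qed

lemma QM_generator:
  assumes "finite J" "j \<in> J"
  shows "c j \<in> QM J c"
proof -
  let ?\<sigma> = "\<lambda>i. if i = j then 1 else 0"
  have "(\<Sum>i\<in>J. ?\<sigma> i * c i) = (\<Sum>i\<in>{j}. ?\<sigma> i * c i)"
    using assms by (intro sum.mono_neutral_right) auto
  then have "c j = 0 + (\<Sum>i\<in>J. ?\<sigma> i * c i)" by simp
  moreover have "\<forall>i\<in>J. ?\<sigma> i \<in> sos" using sos_one sos_zero by auto
  ultimately show ?thesis unfolding QM_def
    using sos_zero by (intro CollectI exI[of _ 0] exI[of _ ?\<sigma>] conjI)
qed

lemma Ideal_generator: "i \<in> I \<Longrightarrow> c i \<in> Ideal I c" "i \<in> I \<Longrightarrow> - c i \<in> Ideal I c"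
  unfolding Ideal_def by (simp_all add: module.span_base[OF Ideal_module] module.span_neg[OF Ideal_module])

lemma mpoly_eval_Ideal:
  assumes "p \<in> Ideal I c" "\<And>i. i \<in> I \<Longrightarrow> mpoly_eval a (c i) = 0"
  shows "mpoly_eval a p = 0"
  using assms(1) unfolding Ideal_def
proof (induction rule: module.span_induct_alt[OF Ideal_module, consumes 1])
  case 1
  then show ?case by simp
next
  case (2 q b r)
  then show ?case using assms(2) by (auto simp: mpoly_eval_add mpoly_eval_mult)
qed

lemma mpoly_eval_QM:
  assumes "p \<in> QM J c" "\<And>j. j \<in> J \<Longrightarrow> mpoly_eval a (c j) \<ge> 0"
  shows "mpoly_eval a p \<ge> 0"
proof -
  obtain \<sigma>0 \<sigma> where "\<sigma>0 \<in> sos" "\<forall>j\<in>J. \<sigma> j \<in> sos" "p = \<sigma>0 + (\<Sum>j\<in>J. \<sigma> j * c j)"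
    using assms(1) unfolding QM_def by blast
  moreover from this have "mpoly_eval a (\<sigma> j) * mpoly_eval a (c j) \<ge> 0" if "j \<in> J" for j
    using assms(2) that by (intro mult_nonneg_nonneg) (auto intro: mpoly_eval_sos)
  ultimately show ?thesis
    by (simp add: mpoly_eval_add mpoly_eval_sum mpoly_eval_mult add_nonneg_nonneg sum_nonneg mpoly_eval_sos)
qed

section \<open>Carleman's inequality\<close>

lemma power_le_exp_fact: "real n ^ n \<le> exp (real n) * fact n"
proof -
  have s: "(\<lambda>k. real n ^ k / fact k) sums exp (real n)"
    using exp_converges[of "real n"] by (simp add: divide_inverse mult.commute)
  have "(\<Sum>k\<in>{n}. real n ^ k / fact k) \<le> suminf (\<lambda>k. real n ^ k / fact k)"
    by (intro sum_le_suminf) (use s in \<open>auto simp: sums_iff\<close>)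
  then have "real n ^ n / fact n \<le> exp (real n)" using s by (simp add: sums_iff)
  then show ?thesis by (simp add: divide_le_eq)
qed

text \<open>The inequality of arithmetic and geometric means for the numbers \<open>(k + 1) c\<^sub>k\<close>, together with
\<open>n! \<ge> (n/e)\<^sup>n\<close>. The weights \<open>k + 1\<close> balance the means so that they can be summed over \<open>n\<close>.\<close>
lemma geometric_mean_le:
  fixes c :: "nat \<Rightarrow> real"
  assumes pos: "\<And>n. c n > 0" and "n > 0"
  shows "(\<Prod>k<n. c k) powr (1 / real n) \<le> exp 1 * ((\<Sum>k<n. real (Suc k) * c k) / (real n)\<^sup>2)"
proof -
  have n0: "n \<noteq> 0" using \<open>n > 0\<close> by simp
  define x where "x k = real (Suc k) * c k" for k
  have x: "x k > 0" for k using pos by (simp add: x_def)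
  define A where "A = (\<Sum>k<n. x k) / n"
  have "A > 0" unfolding A_def using n0 x by (intro divide_pos_pos sum_pos) auto
  have "(\<Sum>k<n. ln (x k / A)) \<le> (\<Sum>k<n. x k / A - 1)"
    by (intro sum_mono ln_le_minus_one divide_pos_pos x \<open>A > 0\<close>)
  also have "\<dots> = (\<Sum>k<n. x k) / A - n" by (simp add: sum_subtractf sum_divide_distrib)
  also have "(\<Sum>k<n. x k) = n * A" using n0 by (simp add: A_def)
  also have "n * A / A - n = 0" using \<open>A > 0\<close> by simp
  finally have le0: "(\<Sum>k<n. ln (x k / A)) \<le> 0" .
  have "(\<Sum>k<n. ln (x k / A)) = (\<Sum>k<n. ln (c k) + ln (real (Suc k)) - ln A)"
  proof (intro sum.cong refl)
    fix k
    have "ln (x k / A) = ln (x k) - ln A" using x[of k] \<open>A > 0\<close> by (simp add: ln_div)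
    also have "ln (x k) = ln (real (Suc k)) + ln (c k)" unfolding x_def using pos[of k] by (intro ln_mult_pos) auto
    finally show "ln (x k / A) = ln (c k) + ln (real (Suc k)) - ln A" by simp
  qed
  also have "\<dots> = (\<Sum>k<n. ln (c k)) + (\<Sum>k<n. ln (real (Suc k))) - n * ln A"
    by (simp add: sum_subtractf sum.distrib)
  finally have 1: "(\<Sum>k<n. ln (c k)) + (\<Sum>k<n. ln (real (Suc k))) \<le> n * ln A" using le0 by simp
  have "(\<Sum>k<n. ln (real (Suc k))) = ln (fact n)"
    by (induction n) (simp_all add: ln_mult_pos)
  moreover have "n * ln (real n) \<le> n + ln (fact n)"
  proof -
    have "ln (real n ^ n) \<le> ln (exp (real n) * fact n)"
      using power_le_exp_fact[of n] n0 by (intro ln_mono) auto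
    also have "\<dots> = n + ln (fact n)" by (subst ln_mult_pos) auto
    finally show ?thesis using n0 by (simp add: ln_realpow)
  qed
  ultimately have "(\<Sum>k<n. ln (c k)) \<le> n * (ln A + 1 - ln n)" using 1 by (simp add: algebra_simps)
  then have 2: "(\<Sum>k<n. ln (c k)) / n \<le> ln A + 1 - ln n" using n0 by (simp add: field_simps)
  have "(\<Prod>k<n. c k) > 0" by (intro prod_pos) (use pos in auto)
  moreover have nz: "c k \<noteq> 0" for k using pos[of k] by simp
  ultimately have "(\<Prod>k<n. c k) powr (1 / real n) = exp (ln (\<Prod>k<n. c k) / n)"
    by (simp add: powr_def)
  also have "ln (\<Prod>k<n. c k) = (\<Sum>k<n. ln (c k))" by (intro ln_prod) (use nz in auto)
  also have "exp ((\<Sum>k<n. ln (c k)) / n) \<le> exp (ln A + 1 - ln n)" using 2 by simp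
  also have "\<dots> = A * exp 1 / n" using \<open>A > 0\<close> n0 by (simp add: exp_diff exp_add)
  also have "\<dots> = exp 1 * ((\<Sum>k<n. x k) / (real n)\<^sup>2)" by (simp add: A_def power2_eq_square)
  finally show ?thesis by (simp add: x_def)
qed

text \<open>The last summand on the left is what \<open>\<Sum>\<^sub>n\<^sub>\<ge>\<^sub>N 1/(n + 1)\<^sup>2 \<le> 1/N\<close> leaves for the terms after \<open>N\<close>; with it
the bound goes through by induction on \<open>N\<close>.\<close>
lemma weighted_means_sum_le:
  fixes c :: "nat \<Rightarrow> real"
  assumes pos: "\<And>n. c n \<ge> 0"
  shows "(\<Sum>n<N. (\<Sum>k<Suc n. real (Suc k) * c k) / (real (Suc n))\<^sup>2) + (\<Sum>k<N. real (Suc k) * c k) / N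
     \<le> 2 * (\<Sum>k<N. c k)"
proof (induction N)
  case (Suc N)
  define T where "T = (\<Sum>k<N. real (Suc k) * c k)"
  have T0: "T \<ge> 0" unfolding T_def using pos by (intro sum_nonneg) auto
  have T: "(\<Sum>k<Suc N. real (Suc k) * c k) = T + real (Suc N) * c N" by (simp add: T_def)
  have "(T + real (Suc N) * c N) / (real (Suc N))\<^sup>2 + (T + real (Suc N) * c N) / real (Suc N) - T / N \<le> 2 * c N"
  proof (cases "N = 0")
    case True
    then show ?thesis by (simp add: T_def)
  next
    case False
    have "1 / (real (Suc N))\<^sup>2 + 1 / real (Suc N) \<le> 1 / N"
      using False by (simp add: divide_simps power2_eq_square) (simp add: algebra_simps)
    then have "T * (1 / (real (Suc N))\<^sup>2 + 1 / real (Suc N)) \<le> T * (1 / N)" using T0 by (rule mult_left_mono)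
    moreover have "real (Suc N) * c N / (real (Suc N))\<^sup>2 \<le> c N"
    proof -
      have "real (Suc N) * c N / (real (Suc N))\<^sup>2 = c N / real (Suc N)"
        by (simp add: power2_eq_square del: of_nat_Suc)
      also have "\<dots> \<le> c N / 1" using pos[of N] by (intro divide_left_mono) auto
      finally show ?thesis by simp
    qed
    moreover have "real (Suc N) * c N / real (Suc N) = c N" by simp
    ultimately show ?thesis by (simp add: add_divide_distrib distrib_left del: of_nat_Suc)
  qed
  then show ?case using Suc.IH unfolding sum.lessThan_Suc[of _ N] T T_def[symmetric] by simp
qed simp

theorem carleman_inequality:
  fixes c :: "nat \<Rightarrow> real"
  assumes pos: "\<And>n. c n > 0" and sum: "summable c"
  shows "summable (\<lambda>n. (\<Prod>k<Suc n. c k) powr (1 / real (Suc n)))"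
proof (rule summableI_nonneg_bounded)
  fix N
  have "(\<Sum>n<N. (\<Prod>k<Suc n. c k) powr (1 / real (Suc n)))
      \<le> (\<Sum>n<N. exp 1 * ((\<Sum>k<Suc n. real (Suc k) * c k) / (real (Suc n))\<^sup>2))"
    by (intro sum_mono geometric_mean_le pos zero_less_Suc)
  also have "\<dots> = exp 1 * (\<Sum>n<N. (\<Sum>k<Suc n. real (Suc k) * c k) / (real (Suc n))\<^sup>2)"
    by (simp only: sum_distrib_left)
  also have "\<dots> \<le> exp 1 * (2 * (\<Sum>k<N. c k))"
  proof (rule mult_left_mono)
    have "(\<Sum>k<N. real (Suc k) * c k) / N \<ge> 0"
      using pos by (intro divide_nonneg_nonneg sum_nonneg mult_nonneg_nonneg) (auto intro: less_imp_le)
    then show "(\<Sum>n<N. (\<Sum>k<Suc n. real (Suc k) * c k) / (real (Suc n))\<^sup>2) \<le> 2 * (\<Sum>k<N. c k)"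
      using weighted_means_sum_le[of c N] pos by (simp add: less_imp_le)
  qed simp
  also have "\<dots> \<le> exp 1 * (2 * suminf c)"
    by (intro mult_left_mono sum_le_suminf sum) (use pos in \<open>auto intro: less_imp_le\<close>)
  finally show "(\<Sum>n<N. (\<Prod>k<Suc n. c k) powr (1 / real (Suc n))) \<le> exp 1 * (2 * suminf c)" .
qed simp

section \<open>Bang's vanishing theorem for quasi-analytic classes\<close>

lemma log_convex_ratio:
  fixes M :: "nat \<Rightarrow> real"
  assumes pos: "\<And>n. M n > 0" and lc: "\<And>n. (M (Suc n))\<^sup>2 \<le> M n * M (Suc (Suc n))"
    and "m \<le> n"
  shows "M (Suc m) / M m \<le> M (Suc n) / M n"
  using \<open>m \<le> n\<close>
proof (induction n rule: dec_induct)
  case (step n)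
  have "M (Suc n) / M n \<le> M (Suc (Suc n)) / M (Suc n)"
    using lc[of n] pos[of n] pos[of "Suc n"] by (simp add: divide_simps power2_eq_square mult.commute)
  then show ?case using step by simp
qed simp

lemma log_convex_growth:
  fixes M :: "nat \<Rightarrow> real"
  assumes pos: "\<And>n. M n > 0" and lc: "\<And>n. (M (Suc n))\<^sup>2 \<le> M n * M (Suc (Suc n))"
    and "j + i \<le> Suc N"
  shows "M (j + i) \<le> M j * (M (Suc N) / M N) ^ i"
  using assms(3)
proof (induction i)
  case (Suc i)
  have "M (j + Suc i) = M (j + i) * (M (Suc (j + i)) / M (j + i))" using pos[of "j + i"] by simp
  also have "\<dots> \<le> (M j * (M (Suc N) / M N) ^ i) * (M (Suc N) / M N)"
    using Suc pos by (intro mult_mono log_convex_ratio[where M = M, OF pos lc]) (auto intro: less_imp_le)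
  finally show ?case by (simp add: mult_ac)
qed simp

lemma exp_partial_sum_le:
  fixes x :: real
  assumes "x \<ge> 0"
  shows "(\<Sum>i\<le>n. x ^ i / fact i) \<le> exp x"
proof -
  have s: "(\<lambda>k. x ^ k / fact k) sums exp x"
    using exp_converges[of x] by (simp add: divide_inverse mult.commute)
  have "(\<Sum>k\<in>{..n}. x ^ k / fact k) \<le> suminf (\<lambda>k. x ^ k / fact k)"
    by (intro sum_le_suminf) (use s assms in \<open>auto simp: sums_iff\<close>)
  then show ?thesis using s by (simp add: sums_iff)
qed

text \<open>Bang measures the smallness of all derivatives at \<open>t\<close> at once by the quotients
\<open>a\<^sub>j(t) / (e\<^sup>j M\<^sub>j)\<close>. If these are at most \<open>e\<^sup>-\<^sup>N\<^sup>-\<^sup>1\<close>, then after a step of length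
\<open>M\<^sub>N / (e M\<^sub>N\<^sub>+\<^sub>1)\<close> they are at most \<open>e\<^sup>-\<^sup>N\<close>: for \<open>j > N\<close> the a priori bound \<open>M\<^sub>j\<close> is good enough, and for
\<open>j \<le> N\<close> one expands to order \<open>N + 1 - j\<close> and uses log-convexity to compare with the exponential series.\<close>
lemma bang_step:
  fixes a :: "nat \<Rightarrow> real \<Rightarrow> real" and M :: "nat \<Rightarrow> real"
  assumes pos: "\<And>n. M n > 0" and lc: "\<And>n. (M (Suc n))\<^sup>2 \<le> M n * M (Suc (Suc n))"
    and bound: "\<And>n t. a n t \<le> M n"
    and taylor: "\<And>j k t h. t \<ge> 0 \<Longrightarrow> h \<ge> 0 \<Longrightarrow>
      a j (t + h) \<le> (\<Sum>i<k. a (j + i) t * h ^ i / fact i) + M (j + k) * h ^ k / fact k"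
    and t: "t \<ge> 0" and h: "0 \<le> h" "h \<le> M N / (exp 1 * M (Suc N))"
    and small: "\<And>j. a j t \<le> exp (real j) * M j * exp (- real (Suc N))"
  shows "a j (t + h) \<le> exp (real j) * M j * exp (- real N)"
proof (cases "j < Suc N")
  case False
  then have "1 \<le> exp (real j) * exp (- real N)" by (simp flip: exp_add)
  then have "M j * 1 \<le> M j * (exp (real j) * exp (- real N))" using pos[of j] by (intro mult_left_mono) auto
  then show ?thesis using bound[of j "t + h"] by (simp add: mult_ac)
next
  case True
  define k where "k = Suc N - j"
  have jk: "j + k = Suc N" using True by (simp add: k_def)
  define R where "R = M (Suc N) / M N"
  define x where "x = exp 1 * h * R"
  have R: "R > 0" unfolding R_def using pos by simp
  have x: "0 \<le> x" "x \<le> 1"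
  proof -
    show "0 \<le> x" using h(1) R by (simp add: x_def)
    have "h * (exp 1 * R) \<le> M N / (exp 1 * M (Suc N)) * (exp 1 * R)"
      using h(2) R by (intro mult_right_mono) auto
    also have "\<dots> = 1" unfolding R_def using pos[of N] pos[of "Suc N"] by simp
    finally show "x \<le> 1" by (simp add: x_def mult_ac)
  qed
  define B where "B = exp (real j) * M j * exp (- real (Suc N))"
  have B: "B \<ge> 0" using pos[of j] by (simp add: B_def)
  have "a j (t + h) \<le> (\<Sum>i<k. a (j + i) t * h ^ i / fact i) + M (j + k) * h ^ k / fact k"
    by (rule taylor[OF t h(1)])
  also have "\<dots> \<le> (\<Sum>i<k. B * (x ^ i / fact i)) + B * (x ^ k / fact k)"
  proof (intro add_mono sum_mono)
    fix i assume "i \<in> {..<k}"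
    then have "M (j + i) \<le> M j * R ^ i" unfolding R_def
      using jk by (intro log_convex_growth[where M = M, OF pos lc]) auto
    have "a (j + i) t * (h ^ i / fact i) \<le> exp (real (j + i)) * M (j + i) * exp (- real (Suc N)) * (h ^ i / fact i)"
      by (rule mult_right_mono[OF small]) (use h(1) in simp)
    also have "\<dots> \<le> exp (real (j + i)) * (M j * R ^ i) * exp (- real (Suc N)) * (h ^ i / fact i)"
      using \<open>M (j + i) \<le> M j * R ^ i\<close> h(1) by (intro mult_right_mono mult_left_mono) auto
    also have "\<dots> = B * (x ^ i / fact i)"
      unfolding B_def x_def by (simp add: exp_add power_mult_distrib exp_of_nat_mult[symmetric] flip: exp_of_nat_mult)
    finally show "a (j + i) t * h ^ i / fact i \<le> B * (x ^ i / fact i)" by simp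
  next
    have "M (j + k) \<le> M j * R ^ k" unfolding R_def
      using jk by (intro log_convex_growth[where M = M, OF pos lc]) auto
    then have "M (j + k) * (h ^ k / fact k) \<le> M j * R ^ k * (h ^ k / fact k)"
      using h(1) by (intro mult_right_mono) auto
    also have "\<dots> = B * (x ^ k / fact k)"
    proof -
      have "exp (real j) * exp (- real (Suc N)) * exp 1 ^ k = 1"
        unfolding jk[symmetric] by (simp flip: exp_add exp_of_nat_mult)
      moreover have "B * (x ^ k / fact k) = (exp (real j) * exp (- real (Suc N)) * exp 1 ^ k) * (M j * R ^ k * (h ^ k / fact k))"
        unfolding B_def x_def by (simp only: power_mult_distrib) (simp add: mult_ac)
      ultimately show ?thesis by simp
    qed
    finally show "M (j + k) * h ^ k / fact k \<le> B * (x ^ k / fact k)" by simp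
  qed
  also have "\<dots> = B * (\<Sum>i\<le>k. x ^ i / fact i)"
    by (simp add: sum_distrib_left lessThan_Suc_atMost[symmetric] distrib_left)
  also have "\<dots> \<le> B * exp 1"
    using exp_partial_sum_le[OF x(1), of k] x(2) B by (intro mult_left_mono) (auto intro: order_trans)
  also have "\<dots> = exp (real j) * M j * exp (- real N)"
    by (simp add: B_def mult_ac flip: exp_add)
  finally show ?thesis .
qed

text \<open>Here \<open>a\<^sub>j\<close> plays the role of the size of the \<open>j\<close>-th derivative; only the Taylor estimates are used, so
\<open>a\<^sub>j\<close> may come from any seminorm. To reach a given \<open>t\<close> with quotients at most \<open>e\<^sup>-\<^sup>N\<close>, start at \<open>0\<close> with a
large index and take the steps of \<open>bang_step\<close> down to \<open>N\<close>. The step lengths have infinite sum, so every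
\<open>t\<close> is reached, whatever \<open>N\<close> is.\<close>
theorem bang_vanishing:
  fixes a :: "nat \<Rightarrow> real \<Rightarrow> real" and M :: "nat \<Rightarrow> real"
  assumes pos: "\<And>n. M n > 0" and lc: "\<And>n. (M (Suc n))\<^sup>2 \<le> M n * M (Suc (Suc n))"
    and div: "\<not> summable (\<lambda>n. M n / M (Suc n))"
    and bound: "\<And>n t. a n t \<le> M n"
    and zero: "\<And>n. a n 0 \<le> 0"
    and taylor: "\<And>j k t h. t \<ge> 0 \<Longrightarrow> h \<ge> 0 \<Longrightarrow>
      a j (t + h) \<le> (\<Sum>i<k. a (j + i) t * h ^ i / fact i) + M (j + k) * h ^ k / fact k"
    and t: "t \<ge> 0"
  shows "a 0 t \<le> 0"
proof -
  define r where "r n = M n / (exp 1 * M (Suc n))" for n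
  have r: "r n \<ge> 0" for n using pos by (simp add: r_def less_imp_le)
  have reach: "a j t \<le> exp (real j) * M j * exp (- real N)"
    if "0 \<le> t" "t \<le> (\<Sum>n\<in>{N..<N+m}. r n)" for m N j t
    using that
  proof (induction m arbitrary: N j t)
    case 0
    then have "t = 0" by simp
    then show ?case using zero[of j] pos[of j] by (simp add: order_trans[OF zero])
  next
    case (Suc m)
    define t' where "t' = max 0 (t - r N)"
    have split: "(\<Sum>n\<in>{N..<N + Suc m}. r n) = r N + (\<Sum>n\<in>{Suc N..<Suc N + m}. r n)"
      using sum.atLeast_Suc_lessThan[of N "N + Suc m" r] by simp
    have "0 \<le> (\<Sum>n\<in>{Suc N..<Suc N + m}. r n)" using r by (intro sum_nonneg) auto
    then have "t' \<le> (\<Sum>n\<in>{Suc N..<Suc N + m}. r n)"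
      using Suc.prems(2) unfolding t'_def split by simp
    then have small: "a j t' \<le> exp (real j) * M j * exp (- real (Suc N))" for j
      by (intro Suc.IH) (auto simp: t'_def)
    have "a j (t' + (t - t')) \<le> exp (real j) * M j * exp (- real N)"
      by (rule bang_step[OF pos lc bound taylor _ _ _ small])
        (use Suc.prems r[of N] in \<open>auto simp: t'_def r_def\<close>)
    then show ?case by simp
  qed
  have "a 0 t \<le> M 0 * exp (- real N)" for N
  proof -
    have "\<not> summable r"
    proof
      assume "summable r"
      then have "summable (\<lambda>n. exp 1 * r n)" by (rule summable_mult)
      then show False using div by (simp add: r_def)
    qed
    then have "\<not> summable (\<lambda>n. r (n + N))" by (simp add: summable_iff_shift)
    then have "\<exists>m. t < (\<Sum>n<m. r (n + N))"
      using summableI_nonneg_bounded[of "\<lambda>n. r (n + N)" t] r by (meson not_less)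
    then obtain m where m: "t < (\<Sum>n<m. r (n + N))" ..
    have "(\<Sum>n<m. r (n + N)) = (\<Sum>n\<in>{N..<N+m}. r n)"
      using sum.shift_bounds_nat_ivl[of r 0 N m] by (simp add: atLeast0LessThan add.commute)
    then show ?thesis using reach[of t N m 0] t m by simp
  qed
  moreover have "(\<lambda>N. M 0 * exp (- real N)) \<longlonglongrightarrow> 0"
  proof -
    have "(\<lambda>N. exp (- real N)) \<longlonglongrightarrow> 0"
      by (intro filterlim_compose[OF exp_at_bot] filterlim_compose[OF filterlim_uminus_at_bot_at_top] filterlim_real_sequentially)
    then show ?thesis by (rule tendsto_mult_right_zero)
  qed
  ultimately show ?thesis by (intro LIMSEQ_le_const[rotated]) auto
qed

section \<open>Square-integrable functions\<close>

definition L2 :: "'a measure \<Rightarrow> ('a \<Rightarrow> real) set" where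
  "L2 \<mu> = {u \<in> borel_measurable \<mu>. integrable \<mu> (\<lambda>x. (u x)\<^sup>2)}"

definition l2norm :: "'a measure \<Rightarrow> ('a \<Rightarrow> real) \<Rightarrow> real" where
  "l2norm \<mu> u = sqrt (\<integral>x. (u x)\<^sup>2 \<partial>\<mu>)"

lemma l2norm_nonneg [simp]: "l2norm \<mu> u \<ge> 0"
  by (simp add: l2norm_def)

lemma l2norm_power2: "(l2norm \<mu> u)\<^sup>2 = (\<integral>x. (u x)\<^sup>2 \<partial>\<mu>)"
  by (simp add: l2norm_def)

lemma L2_measurable [measurable_dest]: "u \<in> L2 \<mu> \<Longrightarrow> u \<in> borel_measurable \<mu>"
  by (simp add: L2_def)

lemma L2_dominated:
  assumes "v \<in> L2 \<mu>" "u \<in> borel_measurable \<mu>" "\<And>x. \<bar>u x\<bar> \<le> \<bar>v x\<bar>"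
  shows "u \<in> L2 \<mu>" "l2norm \<mu> u \<le> l2norm \<mu> v"
proof -
  have v: "integrable \<mu> (\<lambda>x. (v x)\<^sup>2)" using assms(1) by (simp add: L2_def)
  have le: "(u x)\<^sup>2 \<le> (v x)\<^sup>2" for x using assms(3)[of x] by (simp add: abs_le_square_iff)
  have "integrable \<mu> (\<lambda>x. (u x)\<^sup>2)"
    by (rule Bochner_Integration.integrable_bound[OF v]) (use assms(2) le in auto)
  then show "u \<in> L2 \<mu>" "l2norm \<mu> u \<le> l2norm \<mu> v"
    using assms(2) le v by (auto simp: L2_def l2norm_def intro!: integral_mono)
qed

lemma L2_mult_integrable:
  assumes "u \<in> L2 \<mu>" "v \<in> L2 \<mu>"
  shows "integrable \<mu> (\<lambda>x. u x * v x)"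
proof -
  have int: "integrable \<mu> (\<lambda>x. (u x)\<^sup>2 + (v x)\<^sup>2)" using assms by (simp add: L2_def)
  have le: "\<bar>u x * v x\<bar> \<le> \<bar>(u x)\<^sup>2 + (v x)\<^sup>2\<bar>" for x
  proof -
    have "0 \<le> (\<bar>u x\<bar> - \<bar>v x\<bar>)\<^sup>2" by simp
    then have "2 * \<bar>u x * v x\<bar> \<le> (u x)\<^sup>2 + (v x)\<^sup>2"
      by (simp add: power2_diff abs_mult)
    then show ?thesis by simp
  qed
  have "(\<lambda>x. u x * v x) \<in> borel_measurable \<mu>" using assms[THEN L2_measurable] by simp
  then show ?thesis
    by (rule Bochner_Integration.integrable_bound[OF int]) (simp only: real_norm_def le AE_I2)
qed

lemma L2_scale: "u \<in> L2 \<mu> \<Longrightarrow> (\<lambda>x. c * u x) \<in> L2 \<mu>"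
  unfolding L2_def by (simp add: power_mult_distrib borel_measurable_times)

lemma L2_add:
  assumes "u \<in> L2 \<mu>" "v \<in> L2 \<mu>"
  shows "(\<lambda>x. u x + v x) \<in> L2 \<mu>"
proof -
  have "(\<lambda>x. (u x + v x)\<^sup>2) = (\<lambda>x. (u x)\<^sup>2 + (v x)\<^sup>2 + 2 * (u x * v x))"
    by (simp add: power2_sum algebra_simps)
  then show ?thesis using assms L2_mult_integrable[OF assms]
    by (simp add: L2_def borel_measurable_add)
qed

lemma L2_diff:
  assumes "u \<in> L2 \<mu>" "v \<in> L2 \<mu>"
  shows "(\<lambda>x. u x - v x) \<in> L2 \<mu>"
  using L2_add[OF assms(1) L2_scale[OF assms(2), of "-1"]] by simp

lemma l2norm_scale: "l2norm \<mu> (\<lambda>x. c * u x) = \<bar>c\<bar> * l2norm \<mu> u"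
  by (simp add: l2norm_def power_mult_distrib real_sqrt_mult)

lemma cauchy_schwarz_L2:
  assumes "u \<in> L2 \<mu>" "v \<in> L2 \<mu>"
  shows "(\<integral>x. u x * v x \<partial>\<mu>)\<^sup>2 \<le> (\<integral>x. (u x)\<^sup>2 \<partial>\<mu>) * (\<integral>x. (v x)\<^sup>2 \<partial>\<mu>)"
proof -
  let ?a = "\<integral>x. (u x)\<^sup>2 \<partial>\<mu>" and ?b = "\<integral>x. u x * v x \<partial>\<mu>" and ?c = "\<integral>x. (v x)\<^sup>2 \<partial>\<mu>"
  have int: "integrable \<mu> (\<lambda>x. (u x)\<^sup>2)" "integrable \<mu> (\<lambda>x. (v x)\<^sup>2)" "integrable \<mu> (\<lambda>x. u x * v x)"
    using assms L2_mult_integrable[OF assms] by (simp_all add: L2_def)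
  have q: "0 \<le> ?a + 2 * t * ?b + t\<^sup>2 * ?c" for t
  proof -
    have "0 \<le> (\<integral>x. (u x + t * v x)\<^sup>2 \<partial>\<mu>)" by simp
    also have "(\<lambda>x. (u x + t * v x)\<^sup>2) = (\<lambda>x. (u x)\<^sup>2 + 2 * t * (u x * v x) + t\<^sup>2 * (v x)\<^sup>2)"
      by (rule ext) (simp add: power2_eq_square algebra_simps)
    finally show ?thesis using int by simp
  qed
  have c0: "?c \<ge> 0" by simp
  show ?thesis
  proof (cases "?c = 0")
    case True
    have "?b = 0"
    proof (rule ccontr)
      assume "?b \<noteq> 0"
      then have eq: "2 * (- (?a + 1) / (2 * ?b)) * ?b = - (?a + 1)" by simp
      have "0 \<le> ?a + 2 * t * ?b" for t using q[of t] unfolding True by simp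
      from this[of "- (?a + 1) / (2 * ?b)"] have "0 \<le> ?a + - (?a + 1)" by (simp only: eq)
      then show False by simp
    qed
    then show ?thesis by simp
  next
    case False
    then have c: "?c > 0" using c0 by linarith
    have "0 \<le> ?a + 2 * (- ?b / ?c) * ?b + (- ?b / ?c)\<^sup>2 * ?c" by (rule q)
    also have "\<dots> = ?a - ?b\<^sup>2 / ?c" using c by (simp add: power2_eq_square)
    finally show ?thesis using c by (simp add: divide_le_eq)
  qed
qed

lemma integral_mult_le_l2norm:
  assumes "u \<in> L2 \<mu>" "v \<in> L2 \<mu>"
  shows "\<bar>\<integral>x. u x * v x \<partial>\<mu>\<bar> \<le> l2norm \<mu> u * l2norm \<mu> v"
proof -
  have "(\<integral>x. u x * v x \<partial>\<mu>)\<^sup>2 \<le> (l2norm \<mu> u * l2norm \<mu> v)\<^sup>2"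
    using cauchy_schwarz_L2[OF assms] by (simp add: power_mult_distrib l2norm_power2)
  then show ?thesis by (simp add: abs_le_square_iff[symmetric] abs_mult)
qed

lemma l2norm_triangle:
  assumes "u \<in> L2 \<mu>" "v \<in> L2 \<mu>"
  shows "l2norm \<mu> (\<lambda>x. u x + v x) \<le> l2norm \<mu> u + l2norm \<mu> v"
proof (rule power2_le_imp_le)
  have int: "integrable \<mu> (\<lambda>x. (u x)\<^sup>2)" "integrable \<mu> (\<lambda>x. (v x)\<^sup>2)" "integrable \<mu> (\<lambda>x. u x * v x)"
    using assms L2_mult_integrable[OF assms] by (simp_all add: L2_def)
  have "(l2norm \<mu> (\<lambda>x. u x + v x))\<^sup>2 = (\<integral>x. (u x)\<^sup>2 + (v x)\<^sup>2 + 2 * (u x * v x) \<partial>\<mu>)"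
    unfolding l2norm_power2 by (simp add: power2_sum mult_ac)
  also have "\<dots> = (l2norm \<mu> u)\<^sup>2 + (l2norm \<mu> v)\<^sup>2 + 2 * (\<integral>x. u x * v x \<partial>\<mu>)"
    using int by (simp add: l2norm_power2)
  also have "\<dots> \<le> (l2norm \<mu> u + l2norm \<mu> v)\<^sup>2"
    using integral_mult_le_l2norm[OF assms] by (simp add: power2_sum)
  finally show "(l2norm \<mu> (\<lambda>x. u x + v x))\<^sup>2 \<le> (l2norm \<mu> u + l2norm \<mu> v)\<^sup>2" .
qed simp

section \<open>Distance from an algebra of integrable functions\<close>

text \<open>The algebra \<open>P\<close> stands for the polynomial functions. As it is closed under products, integrability of its
elements already gives square integrability.\<close>
locale integrable_algebra =
  fixes \<mu> :: "'a measure" and P :: "('a \<Rightarrow> real) set"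
  assumes P_const: "(\<lambda>_. c) \<in> P"
    and P_add: "p \<in> P \<Longrightarrow> q \<in> P \<Longrightarrow> (\<lambda>x. p x + q x) \<in> P"
    and P_mult: "p \<in> P \<Longrightarrow> q \<in> P \<Longrightarrow> (\<lambda>x. p x * q x) \<in> P"
    and P_integrable: "p \<in> P \<Longrightarrow> integrable \<mu> p"
begin

lemma P_scale: "p \<in> P \<Longrightarrow> (\<lambda>x. c * p x) \<in> P"
  by (rule P_mult[OF P_const])

lemma P_power: "p \<in> P \<Longrightarrow> (\<lambda>x. p x ^ n) \<in> P"
proof (induction n)
  case (Suc n)
  then show ?case using P_mult[of p "\<lambda>x. p x ^ n"] by simp
qed (simp add: P_const)

lemma P_measurable: "p \<in> P \<Longrightarrow> p \<in> borel_measurable \<mu>"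
  using P_integrable borel_measurable_integrable by blast

lemma P_L2: "p \<in> P \<Longrightarrow> p \<in> L2 \<mu>"
  unfolding L2_def using P_measurable P_integrable[OF P_power, of p 2] by simp

definition dist_P :: "('a \<Rightarrow> real) \<Rightarrow> real" where
  "dist_P u = (INF q\<in>P. l2norm \<mu> (\<lambda>x. u x - q x))"

lemma dist_P_le: "q \<in> P \<Longrightarrow> dist_P u \<le> l2norm \<mu> (\<lambda>x. u x - q x)"
  unfolding dist_P_def by (rule cINF_lower) (auto intro!: bdd_belowI[of _ 0])

lemma dist_P_less: "dist_P u < e \<Longrightarrow> \<exists>q\<in>P. l2norm \<mu> (\<lambda>x. u x - q x) < e"
  unfolding dist_P_def using P_const
  by (subst (asm) cINF_less_iff) (auto intro!: bdd_belowI[of _ 0])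

lemma dist_P_le_l2norm: "dist_P u \<le> l2norm \<mu> u"
  using dist_P_le[OF P_const[of 0]] by simp

lemma dist_P_mem: "p \<in> P \<Longrightarrow> dist_P p \<le> 0"
  using dist_P_le[of p p] by (simp add: l2norm_def)

lemma dist_P_add:
  assumes u: "u \<in> L2 \<mu>" and v: "v \<in> L2 \<mu>"
  shows "dist_P (\<lambda>x. u x + v x) \<le> dist_P u + dist_P v"
proof (rule field_le_epsilon)
  fix e :: real assume "e > 0"
  obtain p where p: "p \<in> P" "l2norm \<mu> (\<lambda>x. u x - p x) < dist_P u + e / 2"
    using dist_P_less[of u "dist_P u + e / 2"] \<open>e > 0\<close> by auto
  obtain q where q: "q \<in> P" "l2norm \<mu> (\<lambda>x. v x - q x) < dist_P v + e / 2"
    using dist_P_less[of v "dist_P v + e / 2"] \<open>e > 0\<close> by auto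
  have "dist_P (\<lambda>x. u x + v x) \<le> l2norm \<mu> (\<lambda>x. (u x + v x) - (p x + q x))"
    by (rule dist_P_le[OF P_add[OF p(1) q(1)]])
  also have "\<dots> = l2norm \<mu> (\<lambda>x. (u x - p x) + (v x - q x))" by (simp add: algebra_simps)
  also have "\<dots> \<le> l2norm \<mu> (\<lambda>x. u x - p x) + l2norm \<mu> (\<lambda>x. v x - q x)"
    by (intro l2norm_triangle L2_diff[OF u P_L2[OF p(1)]] L2_diff[OF v P_L2[OF q(1)]])
  finally show "dist_P (\<lambda>x. u x + v x) \<le> dist_P u + dist_P v + e" using p(2) q(2) by simp
qed

lemma dist_P_scale: "dist_P (\<lambda>x. c * u x) \<le> \<bar>c\<bar> * dist_P u"
proof (rule field_le_epsilon)
  fix e :: real assume "e > 0"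
  define e' where "e' = e / (\<bar>c\<bar> + 1)"
  have e': "e' > 0" "\<bar>c\<bar> * e' \<le> e" using \<open>e > 0\<close> by (auto simp: e'_def field_simps)
  obtain p where p: "p \<in> P" "l2norm \<mu> (\<lambda>x. u x - p x) < dist_P u + e'"
    using dist_P_less[of u "dist_P u + e'"] e' by auto
  have "dist_P (\<lambda>x. c * u x) \<le> l2norm \<mu> (\<lambda>x. c * u x - c * p x)"
    by (rule dist_P_le[OF P_scale[OF p(1)]])
  also have "\<dots> = \<bar>c\<bar> * l2norm \<mu> (\<lambda>x. u x - p x)"
    unfolding right_diff_distrib[symmetric] by (rule l2norm_scale)
  also have "\<dots> \<le> \<bar>c\<bar> * (dist_P u + e')" using p(2) by (intro mult_left_mono) auto
  finally show "dist_P (\<lambda>x. c * u x) \<le> \<bar>c\<bar> * dist_P u + e" using e'(2) by (simp add: distrib_left)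
qed

lemma dist_P_sum:
  assumes "finite I" "\<And>i. i \<in> I \<Longrightarrow> u i \<in> L2 \<mu>"
  shows "(\<lambda>x. \<Sum>i\<in>I. u i x) \<in> L2 \<mu> \<and> dist_P (\<lambda>x. \<Sum>i\<in>I. u i x) \<le> (\<Sum>i\<in>I. dist_P (u i))"
  using assms
proof (induction I rule: finite_induct)
  case empty
  then show ?case using dist_P_mem[OF P_const[of 0]] P_L2[OF P_const[of 0]] by simp
next
  case (insert i I)
  then show ?case using L2_add[of "u i" \<mu> "\<lambda>x. \<Sum>i\<in>I. u i x"] dist_P_add[of "u i" "\<lambda>x. \<Sum>i\<in>I. u i x"]
    by force
qed

text \<open>Bounded functions \<open>u\<close> such that multiplication by \<open>u\<close> maps \<open>P\<close> into the \<open>L\<^sup>2\<close>-closure of \<open>P\<close>. Boundedness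
makes them map the closure into itself, which is why products of multipliers are multipliers.\<close>
definition multiplier :: "('a \<Rightarrow> real) set" where
  "multiplier = {u \<in> borel_measurable \<mu>. (\<exists>C. \<forall>x. \<bar>u x\<bar> \<le> C) \<and> (\<forall>p\<in>P. dist_P (\<lambda>x. u x * p x) \<le> 0)}"

lemma bounded_mult_L2:
  assumes "u \<in> borel_measurable \<mu>" "\<And>x. \<bar>u x\<bar> \<le> C" "v \<in> L2 \<mu>"
  shows "(\<lambda>x. u x * v x) \<in> L2 \<mu>" "l2norm \<mu> (\<lambda>x. u x * v x) \<le> \<bar>C\<bar> * l2norm \<mu> v"
proof -
  have m: "(\<lambda>x. u x * v x) \<in> borel_measurable \<mu>" using assms(1) L2_measurable[OF assms(3)] by simp
  have le: "\<bar>u x * v x\<bar> \<le> \<bar>C * v x\<bar>" for x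
    unfolding abs_mult by (intro mult_right_mono) (use assms(2)[of x] in auto)
  show "(\<lambda>x. u x * v x) \<in> L2 \<mu>" by (rule L2_dominated(1)[OF L2_scale[OF assms(3)] m le])
  show "l2norm \<mu> (\<lambda>x. u x * v x) \<le> \<bar>C\<bar> * l2norm \<mu> v"
    using L2_dominated(2)[OF L2_scale[OF assms(3)] m le] by (simp add: l2norm_scale)
qed

lemma multiplier_L2: "u \<in> multiplier \<Longrightarrow> v \<in> L2 \<mu> \<Longrightarrow> (\<lambda>x. u x * v x) \<in> L2 \<mu>"
  unfolding multiplier_def using bounded_mult_L2 by blast

lemma multiplier_const: "(\<lambda>_. c) \<in> multiplier"
  unfolding multiplier_def using dist_P_mem[OF P_scale] by auto

lemma multiplier_add:
  assumes "u \<in> multiplier" "v \<in> multiplier"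
  shows "(\<lambda>x. u x + v x) \<in> multiplier"
proof -
  obtain C D where "\<And>x. \<bar>u x\<bar> \<le> C" "\<And>x. \<bar>v x\<bar> \<le> D" using assms unfolding multiplier_def by blast
  then have "\<bar>u x + v x\<bar> \<le> C + D" for x by (meson abs_triangle_ineq add_mono order_trans)
  moreover have "dist_P (\<lambda>x. (u x + v x) * p x) \<le> 0" if "p \<in> P" for p
    using dist_P_add[OF multiplier_L2[OF assms(1) P_L2[OF that]] multiplier_L2[OF assms(2) P_L2[OF that]]] that assms
    unfolding multiplier_def by (force simp: distrib_right)
  ultimately show ?thesis using assms unfolding multiplier_def by auto
qed

lemma multiplier_mult:
  assumes u: "u \<in> multiplier" and v: "v \<in> multiplier"
  shows "(\<lambda>x. u x * v x) \<in> multiplier"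
proof -
  obtain C D where C: "\<And>x. \<bar>u x\<bar> \<le> C" and D: "\<And>x. \<bar>v x\<bar> \<le> D" using assms unfolding multiplier_def by blast
  have um: "u \<in> borel_measurable \<mu>" using u unfolding multiplier_def by blast
  have "\<bar>u x * v x\<bar> \<le> C * D" for x
    unfolding abs_mult by (intro mult_mono C D) (use abs_ge_zero C order_trans in blast)+
  moreover have "dist_P (\<lambda>x. (u x * v x) * p x) \<le> 0" if p: "p \<in> P" for p
  proof (rule field_le_epsilon)
    fix e :: real assume "e > 0"
    define e' where "e' = e / (\<bar>C\<bar> + 1)"
    have e': "e' > 0" "\<bar>C\<bar> * e' \<le> e" using \<open>e > 0\<close> by (auto simp: e'_def field_simps)
    have "dist_P (\<lambda>x. v x * p x) < e'" using v p e' unfolding multiplier_def by force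
    then obtain q where q: "q \<in> P" "l2norm \<mu> (\<lambda>x. v x * p x - q x) < e'" using dist_P_less by blast
    have vq: "(\<lambda>x. v x * p x - q x) \<in> L2 \<mu>" using L2_diff multiplier_L2[OF v] P_L2 p q(1) by blast
    have "(\<lambda>x. (u x * v x) * p x) = (\<lambda>x. u x * (v x * p x - q x) + u x * q x)"
      by (simp add: algebra_simps)
    then have "dist_P (\<lambda>x. (u x * v x) * p x) \<le> dist_P (\<lambda>x. u x * (v x * p x - q x)) + dist_P (\<lambda>x. u x * q x)"
      using dist_P_add[OF multiplier_L2[OF u vq] multiplier_L2[OF u P_L2[OF q(1)]]] by simp
    also have "dist_P (\<lambda>x. u x * q x) \<le> 0" using u q(1) unfolding multiplier_def by blast
    also have "dist_P (\<lambda>x. u x * (v x * p x - q x)) \<le> l2norm \<mu> (\<lambda>x. u x * (v x * p x - q x))"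
      by (rule dist_P_le_l2norm)
    also have "\<dots> \<le> \<bar>C\<bar> * l2norm \<mu> (\<lambda>x. v x * p x - q x)" by (rule bounded_mult_L2(2)[OF um C vq])
    also have "\<dots> \<le> \<bar>C\<bar> * e'" using q(2) by (intro mult_left_mono) auto
    also have "\<dots> \<le> e" by (rule e'(2))
    finally show "dist_P (\<lambda>x. (u x * v x) * p x) \<le> 0 + e" by simp
  qed
  ultimately show ?thesis using assms unfolding multiplier_def by auto
qed

lemma multiplier_prod: "finite I \<Longrightarrow> (\<And>i. i \<in> I \<Longrightarrow> u i \<in> multiplier) \<Longrightarrow> (\<lambda>x. \<Prod>i\<in>I. u i x) \<in> multiplier"
  by (induction I rule: finite_induct) (simp_all add: multiplier_const multiplier_mult)

lemma multiplier_limit: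
  assumes u: "\<And>n. u n \<in> multiplier" and C: "\<And>n x. \<bar>u n x\<bar> \<le> C"
    and lim: "\<And>x. (\<lambda>n. u n x) \<longlonglongrightarrow> v x"
  shows "v \<in> multiplier"
proof -
  have um: "u n \<in> borel_measurable \<mu>" for n using u unfolding multiplier_def by blast
  have vm: "v \<in> borel_measurable \<mu>" by (rule borel_measurable_LIMSEQ_real[OF lim um])
  have vC: "\<bar>v x\<bar> \<le> C" for x
    using LIMSEQ_le_const2[OF tendsto_rabs[OF lim[of x]]] C by blast
  have "dist_P (\<lambda>x. v x * p x) \<le> 0" if p: "p \<in> P" for p
  proof -
    have pL: "p \<in> L2 \<mu>" by (rule P_L2[OF p])
    have pm: "p \<in> borel_measurable \<mu>" by (rule P_measurable[OF p])
    have "(\<lambda>n. \<integral>x. ((v x - u n x) * p x)\<^sup>2 \<partial>\<mu>) \<longlonglongrightarrow> (\<integral>x. 0 \<partial>\<mu>)"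
    proof (rule integral_dominated_convergence[where w = "\<lambda>x. (2 * C)\<^sup>2 * (p x)\<^sup>2"])
      show "integrable \<mu> (\<lambda>x. (2 * C)\<^sup>2 * (p x)\<^sup>2)" using pL by (simp add: L2_def)
      show "AE x in \<mu>. (\<lambda>n. ((v x - u n x) * p x)\<^sup>2) \<longlonglongrightarrow> 0"
      proof (rule AE_I2)
        fix x
        have "(\<lambda>n. ((v x - u n x) * p x)\<^sup>2) \<longlonglongrightarrow> ((v x - v x) * p x)\<^sup>2"
          by (intro tendsto_intros lim)
        then show "(\<lambda>n. ((v x - u n x) * p x)\<^sup>2) \<longlonglongrightarrow> 0" by simp
      qed
      show "AE x in \<mu>. norm (((v x - u n x) * p x)\<^sup>2) \<le> (2 * C)\<^sup>2 * (p x)\<^sup>2" for n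
      proof (rule AE_I2)
        fix x
        have "\<bar>v x - u n x\<bar> \<le> 2 * C" using C[of n x] vC[of x] by linarith
        then have "(v x - u n x)\<^sup>2 \<le> (2 * C)\<^sup>2" by (intro abs_le_square_iff[THEN iffD1]) simp
        then show "norm (((v x - u n x) * p x)\<^sup>2) \<le> (2 * C)\<^sup>2 * (p x)\<^sup>2"
          by (simp add: power_mult_distrib mult_right_mono)
      qed
    qed (use um vm pm in simp_all)
    then have l0: "(\<lambda>n. l2norm \<mu> (\<lambda>x. (v x - u n x) * p x)) \<longlonglongrightarrow> 0"
      unfolding l2norm_def using tendsto_real_sqrt by fastforce
    have "dist_P (\<lambda>x. v x * p x) \<le> l2norm \<mu> (\<lambda>x. (v x - u n x) * p x)" for n
    proof -
      have "\<bar>v x - u n x\<bar> \<le> 2 * C" for x using C[of n x] vC[of x] by linarith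
      then have L: "(\<lambda>x. (v x - u n x) * p x) \<in> L2 \<mu>"
        using bounded_mult_L2(1)[of "\<lambda>x. v x - u n x" "2 * C" p] um vm pL by simp
      have "dist_P (\<lambda>x. v x * p x) = dist_P (\<lambda>x. (v x - u n x) * p x + u n x * p x)"
        by (simp add: algebra_simps)
      also have "\<dots> \<le> dist_P (\<lambda>x. (v x - u n x) * p x) + dist_P (\<lambda>x. u n x * p x)"
        by (rule dist_P_add[OF L multiplier_L2[OF u pL]])
      also have "dist_P (\<lambda>x. u n x * p x) \<le> 0" using u p unfolding multiplier_def by blast
      finally show ?thesis using dist_P_le_l2norm[of "\<lambda>x. (v x - u n x) * p x"] by simp
    qed
    then show ?thesis using LIMSEQ_le_const[OF l0] by blast
  qed
  then show ?thesis using vm vC unfolding multiplier_def by blast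
qed

end

section \<open>Functions of a quasi-analytic coordinate are multipliers\<close>

lemma sin_taylor_bound:
  fixes a s :: real
  shows "\<bar>sin (a + s) - (\<Sum>i<k. sin (a + i * pi / 2) * s ^ i / fact i)\<bar> \<le> \<bar>s\<bar> ^ k / fact k"
proof -
  define diff where "diff m s = sin (a + s + real m * pi / 2)" for m s
  have D: "\<forall>m x. DERIV (diff m) x :> diff (Suc m) x"
  proof (intro allI)
    fix m x
    have "diff (Suc m) x = cos (a + x + real m * pi / 2)"
      unfolding diff_def using sin_expansion_lemma[of "a + x" m] by simp
    then show "DERIV (diff m) x :> diff (Suc m) x"
      unfolding diff_def by (auto intro!: derivative_eq_intros)
  qed
  obtain t where "diff 0 s = (\<Sum>m<k. diff m 0 / fact m * s ^ m) + diff k t / fact k * s ^ k"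
    using Maclaurin_all_le[OF _ D, of "diff 0" s k] by blast
  then have "sin (a + s) - (\<Sum>i<k. sin (a + i * pi / 2) * s ^ i / fact i) = diff k t / fact k * s ^ k"
    by (simp add: diff_def)
  also have "\<bar>\<dots>\<bar> = \<bar>diff k t\<bar> * (\<bar>s\<bar> ^ k / fact k)" by (simp add: abs_mult power_abs)
  also have "\<dots> \<le> 1 * (\<bar>s\<bar> ^ k / fact k)" by (intro mult_right_mono) (auto simp: diff_def)
  finally show ?thesis by simp
qed

definition quasi_analytic_weights :: "(nat \<Rightarrow> real) \<Rightarrow> bool" where
  "quasi_analytic_weights M \<longleftrightarrow> (\<forall>n. M n > 0) \<and> (\<forall>n. (M (Suc n))\<^sup>2 \<le> M n * M (Suc (Suc n))) \<and>
     \<not> summable (\<lambda>n. M n / M (Suc n))"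

context integrable_algebra
begin

text \<open>For every \<open>p\<close>, the map \<open>t \<mapsto> sin(t f + \<phi>) p\<close> into \<open>L\<^sup>2\<close> has its \<open>n\<close>-th derivative bounded by the norm of
\<open>f\<^sup>n p\<close>; the condition places this map in a quasi-analytic class.\<close>
definition quasi_analytic_function :: "('a \<Rightarrow> real) \<Rightarrow> bool" where
  "quasi_analytic_function f \<longleftrightarrow> f \<in> P \<and> (\<forall>p\<in>P. \<exists>M. quasi_analytic_weights M \<and>
     (\<forall>n. l2norm \<mu> (\<lambda>x. f x ^ n * p x) \<le> M n))"

text \<open>At \<open>t = 0\<close> all derivatives \<open>f\<^sup>n sin(n \<pi>/2) p\<close> of \<open>t \<mapsto> sin(t f) p\<close> lie in \<open>P\<close>, so their distances from
\<open>P\<close> vanish. The distance is a seminorm, hence inherits the Taylor estimates of the sine, and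
\<open>bang_vanishing\<close> applies to it.\<close>
lemma sin_multiplier:
  assumes f: "quasi_analytic_function f" and t: "t \<ge> 0"
  shows "(\<lambda>x. sin (t * f x)) \<in> multiplier"
proof -
  have fP: "f \<in> P" using f unfolding quasi_analytic_function_def by blast
  have fm: "f \<in> borel_measurable \<mu>" by (rule P_measurable[OF fP])
  have "dist_P (\<lambda>x. sin (t * f x) * p x) \<le> 0" if p: "p \<in> P" for p
  proof -
    obtain M where M: "quasi_analytic_weights M" and bnd: "\<And>n. l2norm \<mu> (\<lambda>x. f x ^ n * p x) \<le> M n"
      using f p unfolding quasi_analytic_function_def by blast
    have pm: "p \<in> borel_measurable \<mu>" by (rule P_measurable[OF p])
    have fp: "(\<lambda>x. f x ^ n * p x) \<in> P" for n using P_mult[OF P_power[OF fP] p] .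
    define u where "u n t x = sin (t * f x + real n * pi / 2) * (f x ^ n * p x)" for n t x
    have um: "u n t \<in> borel_measurable \<mu>" for n t unfolding u_def using fm pm by measurable
    have ule: "\<bar>u n t x\<bar> \<le> \<bar>f x ^ n * p x\<bar>" for n t x
      unfolding u_def abs_mult[of "sin _"] by (rule mult_left_le_one_le) auto
    have uL: "u n t \<in> L2 \<mu>" "l2norm \<mu> (u n t) \<le> M n" for n t
      using L2_dominated[OF P_L2[OF fp] um ule] bnd[of n] order_trans by blast+
    define a where "a n t = dist_P (u n t)" for n t
    have "a 0 t \<le> 0"
    proof (rule bang_vanishing[where a = a and M = M])
      show "a n t \<le> M n" for n t
        unfolding a_def using dist_P_le_l2norm[of "u n t"] uL(2)[of n t] by linarith
      show "a n 0 \<le> 0" for n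
        unfolding a_def u_def using dist_P_mem[OF P_scale[OF fp]] by simp
    next
      fix j k and t h :: real
      assume "t \<ge> 0" "h \<ge> 0"
      \<comment> \<open>the Taylor remainder of order \<open>k\<close>\<close>
      define r where "r x = u j (t + h) x - (\<Sum>i<k. (h ^ i / fact i) * u (j + i) t x)" for x
      have rm: "r \<in> borel_measurable \<mu>" unfolding r_def using um by measurable
      have rle: "\<bar>r x\<bar> \<le> \<bar>(h ^ k / fact k) * (f x ^ (j + k) * p x)\<bar>" for x
      proof -
        let ?\<theta> = "t * f x + real j * pi / 2"
        have e: "u (j + i) t x = sin (?\<theta> + i * pi / 2) * (f x ^ j * p x) * f x ^ i" for i
          unfolding u_def by (simp add: power_add algebra_simps add_divide_distrib)
        have sum: "(\<Sum>i<k. (h ^ i / fact i) * u (j + i) t x)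
            = (\<Sum>i<k. sin (?\<theta> + i * pi / 2) * (h * f x) ^ i / fact i) * (f x ^ j * p x)"
          unfolding e sum_distrib_right by (rule sum.cong) (simp_all add: power_mult_distrib)
        have "u j (t + h) x = sin (?\<theta> + h * f x) * (f x ^ j * p x)"
          unfolding u_def by (simp add: algebra_simps)
        then have "r x = (sin (?\<theta> + h * f x) - (\<Sum>i<k. sin (?\<theta> + i * pi / 2) * (h * f x) ^ i / fact i))
            * (f x ^ j * p x)"
          unfolding r_def sum by (simp only: left_diff_distrib)
        then have "\<bar>r x\<bar> = \<bar>sin (?\<theta> + h * f x) - (\<Sum>i<k. sin (?\<theta> + i * pi / 2) * (h * f x) ^ i / fact i)\<bar>
            * \<bar>f x ^ j * p x\<bar>"
          by (simp only: abs_mult)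
        also have "\<dots> \<le> (\<bar>h * f x\<bar> ^ k / fact k) * \<bar>f x ^ j * p x\<bar>"
          by (intro mult_right_mono sin_taylor_bound abs_ge_zero)
        also have "\<dots> = \<bar>(h ^ k / fact k) * (f x ^ (j + k) * p x)\<bar>"
          by (simp add: abs_mult power_mult_distrib power_abs power_add mult_ac)
        finally show ?thesis .
      qed
      have rL: "r \<in> L2 \<mu>" and rn: "l2norm \<mu> r \<le> h ^ k / fact k * M (j + k)"
      proof -
        note L = L2_dominated[OF L2_scale[OF P_L2[OF fp]] rm rle]
        show "r \<in> L2 \<mu>" by (rule L(1))
        have "l2norm \<mu> r \<le> \<bar>h ^ k / fact k\<bar> * l2norm \<mu> (\<lambda>x. f x ^ (j + k) * p x)"
          using L(2) unfolding l2norm_scale .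
        also have "\<dots> \<le> \<bar>h ^ k / fact k\<bar> * M (j + k)" by (intro mult_left_mono bnd) auto
        finally show "l2norm \<mu> r \<le> h ^ k / fact k * M (j + k)" using \<open>h \<ge> 0\<close> by simp
      qed
      have S: "(\<lambda>x. \<Sum>i<k. (h ^ i / fact i) * u (j + i) t x) \<in> L2 \<mu>"
        "dist_P (\<lambda>x. \<Sum>i<k. (h ^ i / fact i) * u (j + i) t x) \<le> (\<Sum>i<k. dist_P (\<lambda>x. (h ^ i / fact i) * u (j + i) t x))"
        using dist_P_sum[of "{..<k}" "\<lambda>i x. (h ^ i / fact i) * u (j + i) t x"] L2_scale[OF uL(1)] by blast+
      have "a j (t + h) = dist_P (\<lambda>x. (\<Sum>i<k. (h ^ i / fact i) * u (j + i) t x) + r x)"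
        unfolding a_def r_def by simp
      also have "\<dots> \<le> (\<Sum>i<k. dist_P (\<lambda>x. (h ^ i / fact i) * u (j + i) t x)) + dist_P r"
        using dist_P_add[OF S(1) rL] S(2) by linarith
      also have "\<dots> \<le> (\<Sum>i<k. a (j + i) t * h ^ i / fact i) + M (j + k) * h ^ k / fact k"
      proof (intro add_mono sum_mono)
        show "dist_P (\<lambda>x. (h ^ i / fact i) * u (j + i) t x) \<le> a (j + i) t * h ^ i / fact i" for i
          using dist_P_scale[of "h ^ i / fact i" "u (j + i) t"] \<open>h \<ge> 0\<close> by (simp add: a_def mult_ac)
        show "dist_P r \<le> M (j + k) * h ^ k / fact k"
          using dist_P_le_l2norm[of r] rn by (simp add: mult_ac)
      qed
      finally show "a j (t + h) \<le> (\<Sum>i<k. a (j + i) t * h ^ i / fact i) + M (j + k) * h ^ k / fact k" .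
    qed (use M t in \<open>auto simp: quasi_analytic_weights_def\<close>)
    moreover have "u 0 t = (\<lambda>x. sin (t * f x) * p x)" by (rule ext) (simp add: u_def)
    ultimately show ?thesis by (simp add: a_def)
  qed
  moreover have "(\<lambda>x. sin (t * f x)) \<in> borel_measurable \<mu>" using fm by measurable
  ultimately show ?thesis unfolding multiplier_def using abs_sin_le_one by blast
qed

lemma polynomial_multiplier:
  assumes g: "real_polynomial_function g" and u: "u \<in> multiplier"
  shows "(\<lambda>x. g (u x :: real)) \<in> multiplier"
  using g
proof induction
  case (linear f)
  then have "f s = s * f 1" for s using linear_simps(5)[of f s 1] bounded_linear.linear by fastforce
  then have "(\<lambda>x. f (u x)) = (\<lambda>x. u x * f 1)" by (rule ext)
  then show ?case using multiplier_mult[OF u multiplier_const[of "f 1"]] by simp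
qed (rule multiplier_const multiplier_add multiplier_mult; assumption?)+

text \<open>Approximate \<open>s \<mapsto> \<psi>(n s)\<close> on \<open>[-1, 1]\<close> by a polynomial and substitute \<open>s = sin(f/n)\<close>. As
\<open>n sin(f/n) \<rightarrow> f\<close>, the resulting multipliers are bounded and converge pointwise to \<open>\<psi>(f)\<close>.\<close>
lemma continuous_function_multiplier:
  assumes f: "quasi_analytic_function f"
    and \<psi>: "continuous_on UNIV \<psi>" and C: "\<And>s. \<bar>\<psi> s\<bar> \<le> C"
  shows "(\<lambda>x. \<psi> (f x)) \<in> multiplier"
proof -
  let ?s = "\<lambda>n x. sin (1 / real (Suc n) * f x)"
  have "\<exists>g. real_polynomial_function g \<and> (\<forall>s\<in>{-1..1}. \<bar>\<psi> (real (Suc n) * s) - g s\<bar> < 1 / real (Suc n))" for n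
  proof -
    have "continuous_on {-1..1} (\<psi> \<circ> (\<lambda>s. real (Suc n) * s))"
      by (intro continuous_on_compose continuous_intros) (rule continuous_on_subset[OF \<psi>], simp)
    then have "continuous_on {-1..1} (\<lambda>s. \<psi> (real (Suc n) * s))" by (simp only: o_def)
    then obtain g where "real_polynomial_function g"
      "\<And>s. s \<in> {-1..1} \<Longrightarrow> \<bar>\<psi> (real (Suc n) * s) - g s\<bar> < 1 / real (Suc n)"
      using Stone_Weierstrass_real_polynomial_function[OF compact_Icc, of "-1" 1 _ "1 / real (Suc n)"]
      by (metis of_nat_0_less_iff zero_less_Suc zero_less_divide_1_iff)
    then show ?thesis by blast
  qed
  then have "\<forall>n. \<exists>g. real_polynomial_function g \<and> (\<forall>s\<in>{-1..1}. \<bar>\<psi> (real (Suc n) * s) - g s\<bar> < 1 / real (Suc n))"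
    by blast
  from choice[OF this] obtain g where g: "\<And>n. real_polynomial_function (g n)"
    and close: "\<And>n s. s \<in> {-1..1} \<Longrightarrow> \<bar>\<psi> (real (Suc n) * s) - g n s\<bar> < 1 / real (Suc n)"
    by blast
  show ?thesis
  proof (rule multiplier_limit[where u = "\<lambda>n x. g n (?s n x)" and C = "C + 1"])
    show "(\<lambda>x. g n (?s n x)) \<in> multiplier" for n
      by (rule polynomial_multiplier[OF g sin_multiplier[OF f]]) simp
    have cl: "\<bar>\<psi> (real (Suc n) * ?s n x) - g n (?s n x)\<bar> < 1 / real (Suc n)" for n x
      by (rule close) auto
    show "\<bar>g n (?s n x)\<bar> \<le> C + 1" for n x
    proof -
      have "1 / real (Suc n) \<le> 1" by simp
      then show ?thesis using cl[of n x] C[of "real (Suc n) * ?s n x"] by linarith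
    qed
    show "(\<lambda>n. g n (?s n x)) \<longlonglongrightarrow> \<psi> (f x)" for x
    proof -
      have "(\<lambda>n. real (Suc n) * ?s n x) \<longlonglongrightarrow> f x"
      proof -
        have "((\<lambda>h. sin (h * f x)) has_real_derivative f x) (at 0)"
          by (auto intro!: derivative_eq_intros)
        then have "(\<lambda>h. (sin ((0 + h) * f x) - sin (0 * f x)) / h) \<midarrow>0\<rightarrow> f x" unfolding DERIV_def .
        then have D: "(\<lambda>h. sin (h * f x) / h) \<midarrow>0\<rightarrow> f x" by simp
        have "filterlim (\<lambda>n. 1 / real (Suc n)) (at 0) sequentially"
          unfolding filterlim_at using LIMSEQ_Suc[OF lim_1_over_n] by auto
        from filterlim_compose[OF D this] show ?thesis by (simp add: mult.commute)
      qed
      moreover have "isCont \<psi> (f x)" using \<psi> by (simp add: continuous_on_eq_continuous_at)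
      ultimately have 1: "(\<lambda>n. \<psi> (real (Suc n) * ?s n x)) \<longlonglongrightarrow> \<psi> (f x)" by (rule isCont_tendsto_compose[rotated])
      have "(\<lambda>n. \<psi> (real (Suc n) * ?s n x) - g n (?s n x)) \<longlonglongrightarrow> 0"
      proof (rule Lim_null_comparison)
        show "\<forall>\<^sub>F n in sequentially. norm (\<psi> (real (Suc n) * ?s n x) - g n (?s n x)) \<le> 1 / real (Suc n)"
          using cl by (auto intro!: always_eventually less_imp_le simp del: of_nat_Suc)
        show "(\<lambda>n. 1 / real (Suc n)) \<longlonglongrightarrow> 0" using LIMSEQ_Suc[OF lim_1_over_n] .
      qed
      from tendsto_diff[OF 1 this] show ?thesis by simp
    qed
  qed
qed

text \<open>If \<open>q\<close> is close to \<open>u\<close> in \<open>L\<^sup>2\<close>, then \<open>\<integral> q\<^sup>2 s\<close> is close to \<open>\<integral> u\<^sup>2 s\<close>. The factor \<open>s\<close> will be the sign of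
a density, which allows signed measures.\<close>
lemma multiplier_square_nonneg:
  assumes u: "u \<in> multiplier" and s: "s \<in> borel_measurable \<mu>" "\<And>x. \<bar>s x\<bar> \<le> 1"
    and pos: "\<And>q. q \<in> P \<Longrightarrow> (\<integral>x. (q x)\<^sup>2 * s x \<partial>\<mu>) \<ge> 0"
  shows "(\<integral>x. (u x)\<^sup>2 * s x \<partial>\<mu>) \<ge> 0"
proof (rule field_le_epsilon)
  fix e :: real assume "e > 0"
  have uL: "u \<in> L2 \<mu>" using multiplier_L2[OF u P_L2[OF P_const[of 1]]] by simp
  \<comment> \<open>with \<open>d = u - q\<close> one has \<open>u\<^sup>2 - q\<^sup>2 = d (2u - d)\<close>, and \<open>B\<close> bounds the norm of the second factor\<close>
  define B where "B = 2 * l2norm \<mu> u + 1"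
  define \<delta> where "\<delta> = min 1 (e / B)"
  have B: "B > 0" unfolding B_def by (rule add_nonneg_pos) auto
  then have \<delta>: "\<delta> > 0" "\<delta> \<le> 1" "\<delta> * B \<le> e" using \<open>e > 0\<close> by (auto simp: \<delta>_def min_def field_simps)
  have "\<forall>p\<in>P. dist_P (\<lambda>x. u x * p x) \<le> 0" using u unfolding multiplier_def by blast
  from bspec[OF this P_const[of 1]] have "dist_P u \<le> 0" by simp
  then obtain q where q: "q \<in> P" "l2norm \<mu> (\<lambda>x. u x - q x) < \<delta>"
    using dist_P_less[of u \<delta>] \<delta>(1) by auto
  let ?d = "\<lambda>x. u x - q x"
  have qL: "q \<in> L2 \<mu>" by (rule P_L2[OF q(1)])
  have dL: "?d \<in> L2 \<mu>" by (rule L2_diff[OF uL qL])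
  have sL: "(\<lambda>x. s x * v x) \<in> L2 \<mu>" "l2norm \<mu> (\<lambda>x. s x * v x) \<le> l2norm \<mu> v" if "v \<in> L2 \<mu>" for v
    using bounded_mult_L2[OF s that] by auto
  have plus: "(\<lambda>x. 2 * u x - ?d x) \<in> L2 \<mu>" by (rule L2_diff[OF L2_scale[OF uL] dL])
  have "l2norm \<mu> (\<lambda>x. 2 * u x + (-1) * ?d x) \<le> l2norm \<mu> (\<lambda>x. 2 * u x) + l2norm \<mu> (\<lambda>x. (-1) * ?d x)"
    by (rule l2norm_triangle[OF L2_scale[OF uL] L2_scale[OF dL]])
  then have np: "l2norm \<mu> (\<lambda>x. 2 * u x - ?d x) \<le> B"
    unfolding l2norm_scale using q(2) \<delta>(2) by (simp add: B_def)
  have int: "integrable \<mu> (\<lambda>x. (u x)\<^sup>2 * s x)" "integrable \<mu> (\<lambda>x. (q x)\<^sup>2 * s x)"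
    using L2_mult_integrable[OF uL sL(1)[OF uL]] L2_mult_integrable[OF qL sL(1)[OF qL]]
    by (simp_all add: power2_eq_square mult_ac)
  have "(\<integral>x. (q x)\<^sup>2 * s x \<partial>\<mu>) - (\<integral>x. (u x)\<^sup>2 * s x \<partial>\<mu>) = (\<integral>x. (q x)\<^sup>2 * s x - (u x)\<^sup>2 * s x \<partial>\<mu>)"
    using int by simp
  also have "\<dots> = - (\<integral>x. ?d x * (s x * (2 * u x - ?d x)) \<partial>\<mu>)"
    unfolding integral_minus[symmetric] by (rule Bochner_Integration.integral_cong) (auto simp: power2_eq_square algebra_simps)
  also have "\<dots> \<le> l2norm \<mu> ?d * l2norm \<mu> (\<lambda>x. s x * (2 * u x - ?d x))"
    using integral_mult_le_l2norm[OF dL sL(1)[OF plus]] by linarith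
  also have "\<dots> \<le> \<delta> * B"
    using q(2) sL(2)[OF plus] np \<delta>(1) by (intro mult_mono) auto
  finally show "0 \<le> (\<integral>x. (u x)\<^sup>2 * s x \<partial>\<mu>) + e"
    using pos[OF q(1)] \<delta>(3) by linarith
qed

end

section \<open>Consequences of the Carleman condition\<close>

text \<open>Adding \<open>1\<close> amounts to adding a unit point mass at \<open>1\<close> to a measure with even moments \<open>m\<^sub>n\<close>. It removes the
degenerate case of vanishing moments.\<close>
lemma log_convex_add_one:
  fixes m :: "nat \<Rightarrow> real"
  assumes nn: "\<And>n. m n \<ge> 0" and lc: "\<And>n. (m (Suc n))\<^sup>2 \<le> m n * m (Suc (Suc n))"
  shows "(m (Suc n) + 1)\<^sup>2 \<le> (m n + 1) * (m (Suc (Suc n)) + 1)"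
proof -
  have "0 \<le> (m n - m (Suc (Suc n)))\<^sup>2" by simp
  then have "4 * (m n * m (Suc (Suc n))) \<le> (m n + m (Suc (Suc n)))\<^sup>2" by (simp add: power2_eq_square algebra_simps)
  then have "(2 * m (Suc n))\<^sup>2 \<le> (m n + m (Suc (Suc n)))\<^sup>2" using lc[of n] by (simp add: power_mult_distrib)
  then have "2 * m (Suc n) \<le> m n + m (Suc (Suc n))" by (rule power2_le_imp_le) (simp add: nn)
  then show ?thesis using lc[of n] by (simp add: power2_eq_square algebra_simps)
qed

text \<open>The product of the first \<open>n\<close> ratios telescopes to \<open>((m\<^sub>0 + 1) / (m\<^sub>n + 1))\<^sup>1\<^sup>/\<^sup>2\<close>, so if the ratios were
summable, Carleman's inequality would make \<open>(m\<^sub>n + 1)\<^sup>-\<^sup>1\<^sup>/\<^sup>2\<^sup>n\<close> summable. In particular these numbers would tend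
to \<open>0\<close>, which forces the moments to be eventually large; then \<open>m\<^sub>n\<close> and \<open>m\<^sub>n + 1\<close> are comparable and Carleman's
condition fails.\<close>
lemma carleman_root_ratio_divergence:
  fixes m :: "nat \<Rightarrow> real"
  assumes nn: "\<And>n. m n \<ge> 0" and lc: "\<And>n. (m (Suc n))\<^sup>2 \<le> m n * m (Suc (Suc n))"
    and carleman: "suminf (\<lambda>d. if m (Suc d) = 0 then \<infinity> else ennreal (m (Suc d) powr (- 1 / (2 * real (Suc d))))) = \<infinity>"
  shows "\<not> summable (\<lambda>n. sqrt ((m n + 1) / (m (Suc n) + 1)))"
proof
  define b where "b n = m n + 1" for n
  define c where "c n = sqrt (b n / b (Suc n))" for n
  define t where "t n = b (Suc n) powr (- 1 / (2 * real (Suc n)))" for n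
  assume "summable (\<lambda>n. sqrt ((m n + 1) / (m (Suc n) + 1)))"
  then have sum: "summable c" by (simp add: c_def[abs_def] b_def)
  have b1: "b n \<ge> 1" for n using nn[of n] by (simp add: b_def)
  then have b0: "b n > 0" for n by (rule less_le_trans[OF zero_less_one])
  have c0: "c n > 0" for n using b0 by (simp add: c_def)
  have prod: "(\<Prod>k<n. c k) = sqrt (b 0 / b n)" for n
  proof (induction n)
    case 0
    then show ?case using b0[of 0] by simp
  next
    case (Suc n)
    then show ?case using b0[of n] by (simp add: c_def flip: real_sqrt_mult)
  qed
  have "summable t"
  proof (rule summable_comparison_test_ev[OF always_eventually carleman_inequality[OF c0 sum]], intro allI)
    fix n
    have "t n = (1 / b (Suc n)) powr (1 / (2 * real (Suc n)))"
      unfolding t_def using b0[of "Suc n"] by (simp add: powr_minus powr_divide field_simps del: of_nat_Suc)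
    also have "\<dots> \<le> (b 0 / b (Suc n)) powr (1 / (2 * real (Suc n)))"
      using b1[of 0] b0[of "Suc n"] by (intro powr_mono2 divide_right_mono) auto
    also have "\<dots> = (\<Prod>k<Suc n. c k) powr (1 / real (Suc n))"
      unfolding prod using b0 by (simp add: powr_half_sqrt[symmetric] powr_powr less_imp_le del: of_nat_Suc)
    finally show "norm (t n) \<le> (\<Prod>k<Suc n. c k) powr (1 / real (Suc n))" by (simp add: t_def)
  qed
  then have "t \<longlonglongrightarrow> 0" by (rule summable_LIMSEQ_zero)
  then have ev: "eventually (\<lambda>n. t n < 1/2) sequentially" by (rule order_tendstoD) simp
  have half: "1/2 \<le> 2 powr (- 1 / (2 * real (Suc n)))" for n
  proof -
    have "2 powr (-1) \<le> 2 powr (- 1 / (2 * real (Suc n)))" by (intro powr_mono) (auto simp: field_simps)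
    then show ?thesis by (simp add: powr_minus)
  qed
  have big: "b (Suc n) > 2" if "t n < 1/2" for n
  proof (rule ccontr)
    assume "\<not> b (Suc n) > 2"
    then have "2 powr (- 1 / (2 * real (Suc n))) \<le> t n"
      unfolding t_def using b0[of "Suc n"] by (intro powr_mono2') (auto simp: field_simps)
    then show False using half[of n] that by linarith
  qed
  \<comment> \<open>by log-convexity, one vanishing moment would force all later ones to vanish, against \<open>big\<close>\<close>
  have pos: "m (Suc n) > 0" for n
  proof (rule ccontr)
    assume "\<not> m (Suc n) > 0"
    then have 0: "m (Suc n) = 0" using nn[of "Suc n"] by linarith
    have "m (Suc n + k) = 0" for k
    proof (induction k)
      case (Suc k)
      then show ?case using lc[of "Suc n + k"] by simp
    qed (simp add: 0)
    moreover obtain N where "\<And>k. k \<ge> N \<Longrightarrow> t k < 1/2" using ev by (auto simp: eventually_sequentially)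
    then have "b (Suc (n + N)) > 2" by (intro big) simp
    ultimately show False unfolding b_def by (metis add_Suc add_0 not_numeral_less_one)
  qed
  let ?x = "\<lambda>n. m (Suc n) powr (- 1 / (2 * real (Suc n)))"
  have "summable ?x"
  proof (rule summable_comparison_test_ev[OF _ summable_mult[OF \<open>summable t\<close>, of 2]])
    show "eventually (\<lambda>n. norm (?x n) \<le> 2 * t n) sequentially"
      using ev
    proof eventually_elim
      case (elim n)
      have "?x n \<le> (b (Suc n) / 2) powr (- 1 / (2 * real (Suc n)))"
        using big[OF elim] by (intro powr_mono2') (auto simp: b_def field_simps)
      also have "\<dots> = t n / 2 powr (- 1 / (2 * real (Suc n)))"
        unfolding t_def using b0[of "Suc n"] by (simp add: powr_divide del: of_nat_Suc)
      also have "\<dots> \<le> t n / (1/2)"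
        using half[of n] by (intro divide_left_mono) (auto simp: t_def)
      finally show ?case by simp
    qed
  qed
  then have "suminf (\<lambda>n. ennreal (?x n)) = ennreal (suminf ?x)" by (intro suminf_ennreal2) auto
  moreover have "(\<lambda>d. if m (Suc d) = 0 then \<infinity> else ennreal (?x d)) = (\<lambda>d. ennreal (?x d))"
    using pos by (auto simp: less_le)
  ultimately show False using carleman by simp
qed

lemma summable_odd_subsequence:
  fixes c :: "nat \<Rightarrow> real"
  assumes nn: "\<And>n. c n \<ge> 0" and dec: "\<And>n. c (Suc n) \<le> c n"
    and sum: "summable (\<lambda>n. c (Suc (2 * n)))"
  shows "summable c"
proof -
  have le: "(\<Sum>k<2 * N. c (Suc k)) \<le> 2 * (\<Sum>n<N. c (Suc (2 * n)))" for N
  proof (induction N)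
    case (Suc N)
    then show ?case using dec[of "Suc (2 * N)"] by simp
  qed simp
  have "summable (\<lambda>k. c (Suc k))"
  proof (rule summableI_nonneg_bounded)
    fix N
    have "(\<Sum>k<N. c (Suc k)) \<le> (\<Sum>k<2 * N. c (Suc k))" by (intro sum_mono2) (auto simp: nn)
    also have "\<dots> \<le> 2 * (\<Sum>n<N. c (Suc (2 * n)))" by (rule le)
    also have "\<dots> \<le> 2 * suminf (\<lambda>n. c (Suc (2 * n)))" by (intro mult_left_mono sum_le_suminf sum) (auto simp: nn)
    finally show "(\<Sum>k<N. c (Suc k)) \<le> 2 * suminf (\<lambda>n. c (Suc (2 * n)))" .
  qed (rule nn)
  then show ?thesis by (simp add: summable_Suc_iff)
qed

text \<open>The weight \<open>|h|\<close> and the factor \<open>p\<close> are split off by the Cauchy-Schwarz inequality, which replaces the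
moment of order \<open>2n\<close> under a square root by that of order \<open>4n\<close> under a fourth root. Divergence survives this
passage to every second moment because the ratios decrease.\<close>
lemma fourth_root_weights:
  fixes b :: "nat \<Rightarrow> real"
  assumes pos: "\<And>n. b n > 0" and lc: "\<And>n. (b (Suc n))\<^sup>2 \<le> b n * b (Suc (Suc n))"
    and div: "\<not> summable (\<lambda>n. sqrt (b n / b (Suc n)))" and "C > 0"
  shows "quasi_analytic_weights (\<lambda>n. C * sqrt (sqrt (b (2 * n))))"
  unfolding quasi_analytic_weights_def
proof (intro conjI allI)
  fix n
  show "C * sqrt (sqrt (b (2 * n))) > 0" using pos \<open>C > 0\<close> by simp
  have ratio: "b (Suc m) / b m \<le> b (Suc n) / b n" if "m \<le> n" for m n
    by (rule log_convex_ratio[where M = b, OF pos lc that])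
  have "b (Suc (Suc (2 * n))) / b (2 * n) = (b (Suc (2 * n)) / b (2 * n)) * (b (Suc (Suc (2 * n))) / b (Suc (2 * n)))"
    using pos[of "Suc (2 * n)"] by simp
  also have "\<dots> \<le> (b (Suc (Suc (Suc (2 * n)))) / b (Suc (Suc (2 * n)))) *
      (b (Suc (Suc (Suc (Suc (2 * n))))) / b (Suc (Suc (Suc (2 * n)))))"
    using pos by (intro mult_mono ratio) (auto intro!: divide_nonneg_nonneg less_imp_le)
  also have "\<dots> = b (Suc (Suc (Suc (Suc (2 * n))))) / b (Suc (Suc (2 * n)))"
    using pos[of "Suc (Suc (Suc (2 * n)))"] by simp
  finally have "(b (Suc (Suc (2 * n))))\<^sup>2 \<le> b (2 * n) * b (Suc (Suc (Suc (Suc (2 * n)))))"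
    using pos[of "2 * n"] pos[of "Suc (Suc (2 * n))"] by (simp add: divide_simps power2_eq_square mult.commute)
  then have "(b (2 * Suc n))\<^sup>2 \<le> b (2 * n) * b (2 * Suc (Suc n))" by simp
  then have "sqrt (sqrt ((b (2 * Suc n))\<^sup>2)) \<le> sqrt (sqrt (b (2 * n) * b (2 * Suc (Suc n))))"
    by (intro real_sqrt_le_mono)
  then have "sqrt (b (2 * Suc n)) \<le> sqrt (sqrt (b (2 * n))) * sqrt (sqrt (b (2 * Suc (Suc n))))"
    using pos[of "2 * Suc n"] by (simp add: real_sqrt_mult)
  then have "C\<^sup>2 * sqrt (b (2 * Suc n)) \<le> C\<^sup>2 * (sqrt (sqrt (b (2 * n))) * sqrt (sqrt (b (2 * Suc (Suc n)))))"
    by (intro mult_left_mono) auto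
  then show "(C * sqrt (sqrt (b (2 * Suc n))))\<^sup>2 \<le> C * sqrt (sqrt (b (2 * n))) * (C * sqrt (sqrt (b (2 * Suc (Suc n)))))"
    using pos[of "2 * Suc n"] by (simp add: power_mult_distrib less_imp_le power2_eq_square mult_ac)
next
  define c where "c n = sqrt (b n / b (Suc n))" for n
  have c0: "c n \<ge> 0" for n using pos by (simp add: c_def less_imp_le)
  have dec: "c (Suc n) \<le> c n" for n
    unfolding c_def real_sqrt_le_iff using lc[of n] pos[of "Suc n"] pos[of "Suc (Suc n)"]
    by (simp add: divide_simps power2_eq_square mult.commute)
  have le: "c (Suc (2 * n)) \<le> C * sqrt (sqrt (b (2 * n))) / (C * sqrt (sqrt (b (2 * Suc n))))" for n
  proof -
    have "c (Suc (2 * n)) = sqrt (c (Suc (2 * n)) * c (Suc (2 * n)))" using c0 by simp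
    also have "\<dots> \<le> sqrt (c (2 * n) * c (Suc (2 * n)))"
      unfolding real_sqrt_le_iff by (intro mult_right_mono dec c0)
    also have "\<dots> = sqrt (sqrt (b (2 * n) / b (Suc (Suc (2 * n)))))"
      unfolding c_def real_sqrt_mult[symmetric] using pos[of "Suc (2 * n)"] by simp
    also have "\<dots> = C * sqrt (sqrt (b (2 * n))) / (C * sqrt (sqrt (b (2 * Suc n))))"
      using \<open>C > 0\<close> by (simp add: real_sqrt_divide)
    finally show ?thesis .
  qed
  show "\<not> summable (\<lambda>n. C * sqrt (sqrt (b (2 * n))) / (C * sqrt (sqrt (b (2 * Suc n)))))"
  proof
    assume "summable (\<lambda>n. C * sqrt (sqrt (b (2 * n))) / (C * sqrt (sqrt (b (2 * Suc n)))))"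
    then have "summable (\<lambda>n. c (Suc (2 * n)))"
      by (rule summable_comparison_test_ev[rotated]) (use le c0 in \<open>auto intro!: always_eventually\<close>)
    then have "summable c" by (rule summable_odd_subsequence[where c = c, OF c0 dec])
    then show False using div by (simp add: c_def[abs_def])
  qed
qed

lemma AE_measure_support:
  fixes \<nu> :: "'a::second_countable_topology measure"
  assumes "sets \<nu> = sets borel"
  shows "AE y in \<nu>. y \<in> measure_support \<nu>"
proof -
  obtain B :: "'a set set" where B: "countable B" "topological_basis B" using ex_countable_basis by blast
  define N where "N = {U\<in>B. emeasure \<nu> U = 0}"
  have op: "open U" if "U \<in> B" for U using B(2) that by (rule topological_basis_open)
  have "AE y in \<nu>. y \<notin> U" if "U \<in> N" for U
    using that op[of U] assms by (intro AE_not_in null_setsI) (auto simp: N_def)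
  then have "AE y in \<nu>. \<forall>U\<in>N. y \<notin> U"
    using B(1) by (subst AE_ball_countable) (auto simp: N_def)
  then show ?thesis
  proof eventually_elim
    case (elim y)
    show ?case unfolding measure_support_def
    proof (intro CollectI allI impI, elim conjE)
      fix U assume U: "open U" "y \<in> U"
      then obtain V where V: "V \<in> B" "y \<in> V" "V \<subseteq> U" using topological_basisE[OF B(2)] by metis
      then have "emeasure \<nu> V \<noteq> 0" using elim by (auto simp: N_def)
      moreover have "emeasure \<nu> V \<le> emeasure \<nu> U" using V U assms by (intro emeasure_mono) auto
      ultimately show "emeasure \<nu> U > 0" by (metis le_zero_eq not_gr_zero)
    qed
  qed
qed

text \<open>The multiplier algebra is formed with respect to the positive measure \<open>\<mu> = |h| \<nu>\<close>, so that
\<open>h d\<nu> = sgn(h) d\<mu>\<close>. The functions \<open>y\<^sub>j\<close> are quasi-analytic for \<open>\<mu>\<close>, hence products of tent functions of the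
coordinates are multipliers.\<close>
theorem localized_nonneg_imp_nonneg_on_support:
  fixes \<nu> :: "(real ^ 'm::finite) measure" and P :: "(real ^ 'm \<Rightarrow> real) set"
  assumes sets: "sets \<nu> = sets borel" and carleman: "multivariate_carleman \<nu>"
    and P: "integrable_algebra \<nu> P" and coord: "\<And>j. (\<lambda>y. y $ j) \<in> P"
    and h: "h \<in> P" "continuous_on UNIV h"
    and pos: "\<And>q. q \<in> P \<Longrightarrow> (\<integral>y. (q y)\<^sup>2 * h y \<partial>\<nu>) \<ge> 0"
    and y0: "y0 \<in> measure_support \<nu>"
  shows "h y0 \<ge> 0"
proof (rule ccontr)
  assume "\<not> h y0 \<ge> 0"
  interpret P: integrable_algebra \<nu> P by (rule P)
  have hm: "h \<in> borel_measurable \<nu>" by (rule P.P_measurable[OF h(1)])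
  define \<mu> where "\<mu> = density \<nu> (\<lambda>y. ennreal \<bar>h y\<bar>)"
  have m\<mu>: "borel_measurable \<mu> = borel_measurable \<nu>" unfolding \<mu>_def by (auto simp: measurable_def)
  have int_\<mu>: "integrable \<mu> f \<longleftrightarrow> integrable \<nu> (\<lambda>y. \<bar>h y\<bar> * f y)"
    and integral_\<mu>: "integral\<^sup>L \<mu> f = (\<integral>y. \<bar>h y\<bar> * f y \<partial>\<nu>)"
    if "f \<in> borel_measurable \<nu>" for f :: "real ^ 'm \<Rightarrow> real"
    unfolding \<mu>_def using hm that by (simp_all add: integrable_density integral_density)
  interpret \<mu>: integrable_algebra \<mu> P
  proof
    show "integrable \<mu> p" if p: "p \<in> P" for p
      unfolding int_\<mu>[OF P.P_measurable[OF p]]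
      by (rule Bochner_Integration.integrable_bound[OF P.P_integrable[OF P.P_mult[OF h(1) p]]])
        (use hm P.P_measurable[OF p] in \<open>auto simp: abs_mult\<close>)
  qed (rule P.P_const P.P_add P.P_mult; assumption)+
  have qa: "\<mu>.quasi_analytic_function (\<lambda>y. y $ j)" for j
    unfolding \<mu>.quasi_analytic_function_def
  proof (intro conjI ballI)
    fix p assume p: "p \<in> P"
    define m where "m n = (\<integral>y. (y $ j) ^ (2 * n) \<partial>\<nu>)" for n
    have yn: "(\<lambda>y. (y $ j) ^ n) \<in> P" for n by (rule P.P_power[OF coord])
    have m_sq: "m n = (\<integral>y. ((y $ j) ^ n)\<^sup>2 \<partial>\<nu>)" for n by (simp add: m_def power_mult[symmetric] mult.commute)
    have nn: "m n \<ge> 0" for n unfolding m_sq by simp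
    have lc: "(m (Suc n))\<^sup>2 \<le> m n * m (Suc (Suc n))" for n
    proof -
      have "(\<integral>y. (y $ j) ^ n * (y $ j) ^ Suc (Suc n) \<partial>\<nu>)\<^sup>2 \<le> m n * m (Suc (Suc n))"
        unfolding m_sq by (rule cauchy_schwarz_L2[OF P.P_L2[OF yn] P.P_L2[OF yn]])
      moreover have "(\<lambda>y :: real ^ 'm. (y $ j) ^ n * (y $ j) ^ Suc (Suc n)) = (\<lambda>y. (y $ j) ^ (2 * Suc n))"
        unfolding power_add[symmetric] by (simp add: mult_2)
      ultimately show ?thesis by (simp only: m_def)
    qed
    have car: "suminf (\<lambda>d. if m (Suc d) = 0 then \<infinity> else ennreal (m (Suc d) powr (- 1 / (2 * real (Suc d))))) = \<infinity>"
      using carleman unfolding multivariate_carleman_def carleman_term_def Let_def m_def by blast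
    define K where "K = (\<integral>y. ((p y)\<^sup>2 * h y)\<^sup>2 \<partial>\<nu>)"
    have K: "K \<ge> 0" unfolding K_def by simp
    define C where "C = sqrt (sqrt K) + 1"
    have C: "C > 0" unfolding C_def by (rule add_nonneg_pos) (use K in auto)
    have "quasi_analytic_weights (\<lambda>n. C * sqrt (sqrt (m (2 * n) + 1)))"
      by (rule fourth_root_weights[OF _ log_convex_add_one[where m = m, OF nn lc]
            carleman_root_ratio_divergence[where m = m, OF nn lc car] C])
        (use nn in \<open>auto intro: add_nonneg_pos\<close>)
    moreover have "l2norm \<mu> (\<lambda>y. (y $ j) ^ n * p y) \<le> C * sqrt (sqrt (m (2 * n) + 1))" for n
    proof -
      have p2h: "(\<lambda>y. (p y)\<^sup>2 * h y) \<in> P" by (rule P.P_mult[OF P.P_power[OF p] h(1)])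
      have abs: "(\<lambda>y. \<bar>(p y)\<^sup>2 * h y\<bar>) \<in> L2 \<nu>"
        by (rule L2_dominated(1)[OF P.P_L2[OF p2h]]) (use P.P_measurable[OF p2h] in auto)
      have "(\<integral>y. ((y $ j) ^ n * p y)\<^sup>2 \<partial>\<mu>) = (\<integral>y. \<bar>h y\<bar> * ((y $ j) ^ n * p y)\<^sup>2 \<partial>\<nu>)"
        by (rule integral_\<mu>[OF P.P_measurable[OF P.P_power[OF P.P_mult[OF yn p]]]])
      also have "\<dots> = (\<integral>y. (y $ j) ^ (2 * n) * \<bar>(p y)\<^sup>2 * h y\<bar> \<partial>\<nu>)"
        by (simp add: power_mult_distrib abs_mult power_mult[symmetric] mult_ac)
      also have "\<dots> \<le> l2norm \<nu> (\<lambda>y. (y $ j) ^ (2 * n)) * l2norm \<nu> (\<lambda>y. \<bar>(p y)\<^sup>2 * h y\<bar>)"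
        using integral_mult_le_l2norm[OF P.P_L2[OF yn] abs] by (simp add: abs_le_iff)
      also have "l2norm \<nu> (\<lambda>y. (y $ j) ^ (2 * n)) = sqrt (m (2 * n))"
        unfolding l2norm_def m_sq ..
      also have "l2norm \<nu> (\<lambda>y. \<bar>(p y)\<^sup>2 * h y\<bar>) = sqrt K" unfolding l2norm_def K_def by simp
      finally have "l2norm \<mu> (\<lambda>y. (y $ j) ^ n * p y) \<le> sqrt (sqrt (m (2 * n)) * sqrt K)"
        unfolding l2norm_def[of \<mu>] by simp
      also have "\<dots> = sqrt (sqrt K) * sqrt (sqrt (m (2 * n)))" by (simp add: real_sqrt_mult mult.commute)
      also have "\<dots> \<le> C * sqrt (sqrt (m (2 * n) + 1))"
        using K nn by (intro mult_mono) (auto simp: C_def)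
      finally show ?thesis .
    qed
    ultimately show "\<exists>M. quasi_analytic_weights M \<and> (\<forall>n. l2norm \<mu> (\<lambda>x. (x $ j) ^ n * p x) \<le> M n)" by blast
  qed (rule coord)
  have "open {y. h y < 0}"
    using open_Collect_less[OF h(2) continuous_on_const[of UNIV "0::real"]] by simp
  then obtain e where e: "e > 0" "ball y0 e \<subseteq> {y. h y < 0}"
    using \<open>\<not> h y0 \<ge> 0\<close> open_contains_ball_eq by (metis (mono_tags, lifting) mem_Collect_eq not_less)
  \<comment> \<open>chosen so that the cube of half-width \<open>\<delta>\<close> around \<open>y0\<close> lies in the ball of radius \<open>e\<close>\<close>
  define \<delta> where "\<delta> = e / CARD('m)"
  have \<delta>: "\<delta> > 0" using e by (simp add: \<delta>_def)
  define \<psi> where "\<psi> j s = max 0 (\<delta> - \<bar>s - y0 $ j\<bar>)" for j s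
  define u where "u y = (\<Prod>j\<in>UNIV. \<psi> j (y $ j))" for y :: "real ^ 'm"
  have mult: "u \<in> \<mu>.multiplier"
    unfolding u_def
  proof (rule \<mu>.multiplier_prod)
    show "(\<lambda>y. \<psi> j (y $ j)) \<in> \<mu>.multiplier" for j
    proof (rule \<mu>.continuous_function_multiplier[OF qa])
      show "continuous_on UNIV (\<psi> j)" unfolding \<psi>_def by (intro continuous_intros)
      show "\<bar>\<psi> j s\<bar> \<le> \<delta>" for s using \<delta> by (auto simp: \<psi>_def)
    qed
  qed simp
  have um: "u \<in> borel_measurable \<nu>" using mult unfolding \<mu>.multiplier_def m\<mu> by blast
  have neg: "h y < 0" if "u y \<noteq> 0" for y
  proof -
    have lt: "\<bar>(y - y0) $ j\<bar> < \<delta>" for j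
    proof -
      have "\<psi> j (y $ j) \<noteq> 0" using that by (simp add: u_def)
      then show ?thesis by (simp add: \<psi>_def max_def split: if_splits)
    qed
    have "norm (y - y0) \<le> (\<Sum>j\<in>UNIV. \<bar>(y - y0) $ j\<bar>)" by (rule norm_le_l1_cart)
    also have "\<dots> < (\<Sum>j\<in>(UNIV :: 'm set). \<delta>)" by (intro sum_strict_mono lt) auto
    also have "\<dots> = e" by (simp add: \<delta>_def)
    finally show ?thesis using e(2) by (auto simp: dist_norm norm_minus_commute)
  qed
  have upos: "u y \<noteq> 0" if "y \<in> ball y0 \<delta>" for y
  proof -
    have "\<bar>(y - y0) $ j\<bar> < \<delta>" for j
      using component_le_norm_cart[of "y - y0" j] that by (simp add: dist_norm norm_minus_commute)
    then have "\<psi> j (y $ j) > 0" for j by (simp add: \<psi>_def)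
    then have "u y > 0" unfolding u_def by (intro prod_pos) auto
    then show ?thesis by simp
  qed
  have sgn: "\<bar>h y\<bar> * (v * sgn (h y)) = v * h y" for v y by (simp add: abs_mult_sgn mult.left_commute mult.commute)
  have "(\<integral>y. (u y)\<^sup>2 * sgn (h y) \<partial>\<mu>) \<ge> 0"
  proof (rule \<mu>.multiplier_square_nonneg[OF mult])
    show "(\<lambda>y. sgn (h y)) \<in> borel_measurable \<mu>" unfolding m\<mu> using hm by measurable
    show "\<bar>sgn (h y)\<bar> \<le> 1" for y by (simp add: abs_sgn_eq)
    show "(\<integral>y. (q y)\<^sup>2 * sgn (h y) \<partial>\<mu>) \<ge> 0" if q: "q \<in> P" for q
    proof -
      have "(\<integral>y. (q y)\<^sup>2 * sgn (h y) \<partial>\<mu>) = (\<integral>y. (q y)\<^sup>2 * h y \<partial>\<nu>)"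
        using integral_\<mu>[of "\<lambda>y. (q y)\<^sup>2 * sgn (h y)"] P.P_measurable[OF q] hm by (simp add: sgn)
      then show ?thesis using pos[OF q] by simp
    qed
  qed
  also have "(\<integral>y. (u y)\<^sup>2 * sgn (h y) \<partial>\<mu>) = (\<integral>y. (u y)\<^sup>2 * h y \<partial>\<nu>)"
    using integral_\<mu>[of "\<lambda>y. (u y)\<^sup>2 * sgn (h y)"] um hm by (simp add: sgn)
  finally have ge: "(\<integral>y. (u y)\<^sup>2 * h y \<partial>\<nu>) \<ge> 0" .
  have le: "0 \<le> - ((u y)\<^sup>2 * h y)" for y
    using neg[of y] by (cases "u y = 0") (auto simp: mult_nonneg_nonpos less_imp_le)
  have "integrable \<nu> (\<lambda>y. \<bar>h y\<bar> * (u y)\<^sup>2)"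
  proof -
    have "u \<in> L2 \<mu>" using \<mu>.multiplier_L2[OF mult \<mu>.P_L2[OF P.P_const[of 1]]] by simp
    then show ?thesis using int_\<mu>[of "\<lambda>y. (u y)\<^sup>2"] um by (simp add: L2_def)
  qed
  moreover have "\<bar>h y\<bar> * (u y)\<^sup>2 = - ((u y)\<^sup>2 * h y)" for y
    using neg[of y] by (cases "u y = 0") auto
  ultimately have int: "integrable \<nu> (\<lambda>y. - ((u y)\<^sup>2 * h y))" by simp
  have "(\<integral>y. - ((u y)\<^sup>2 * h y) \<partial>\<nu>) = 0"
    using ge Bochner_Integration.integral_nonneg[of \<nu> "\<lambda>y. - ((u y)\<^sup>2 * h y)", OF le] by simp
  then have "AE y in \<nu>. - ((u y)\<^sup>2 * h y) = 0"
    using integral_nonneg_eq_0_iff_AE[OF int] le by simp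
  then have "AE y in \<nu>. y \<notin> ball y0 \<delta>"
  proof eventually_elim
    case (elim y)
    then show ?case using neg[of y] upos[of y] by auto
  qed
  then have "emeasure \<nu> (ball y0 \<delta>) = 0"
    using sets by (subst (asm) AE_iff_measurable[of "ball y0 \<delta>"]) (auto simp: sets_eq_imp_space_eq[OF sets])
  moreover have "emeasure \<nu> (ball y0 \<delta>) > 0"
    using y0 \<delta> unfolding measure_support_def by auto
  ultimately show False by simp
qed

section \<open>Exactness of the relaxation\<close>

lemma quadratic_module_sum:
  fixes \<nu> :: "(real ^ 'm::finite) measure" and g :: "nat \<Rightarrow> ('n::finite + 'm) mpoly"
  shows "quadratic_module (QM_measure s g \<nu> + Ideal I c + QM J c)" (is "quadratic_module ?M")
    and "QM_measure s g \<nu> \<subseteq> QM_measure s g \<nu> + Ideal I c + QM J c"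
    and "Ideal I c \<subseteq> QM_measure s g \<nu> + Ideal I c + QM J c"
    and "QM J c \<subseteq> QM_measure s g \<nu> + Ideal I c + QM J c"
proof -
  note cones = square_cone_QM_measure[of s g \<nu>] square_cone_Ideal[of I c] square_cone_QM[of J c]
  have zero: "0 \<in> QM_measure s g \<nu>" "0 \<in> Ideal I c" "0 \<in> QM J c"
    using cones unfolding square_cone_def by blast+
  have mem: "p + q + r \<in> ?M" if "p \<in> QM_measure s g \<nu>" "q \<in> Ideal I c" "r \<in> QM J c" for p q r
    using that by (intro set_plus_intro)
  show 1: "QM_measure s g \<nu> \<subseteq> ?M" using mem[OF _ zero(2,3)] by auto
  show 2: "Ideal I c \<subseteq> ?M" using mem[OF zero(1) _ zero(3)] by auto
  show 3: "QM J c \<subseteq> ?M" using mem[OF zero(1,2)] by auto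
  have "square_cone ?M" using cones by (intro square_cone_plus)
  then show "quadratic_module ?M"
    using 3 one_in_QM[of J c] unfolding square_cone_def quadratic_module_def by blast
qed

lemma continuous_on_poly_at2:
  fixes p :: "('n::finite + 'm::finite) mpoly"
  shows "continuous_on UNIV (poly_at2 p x)"
proof -
  have "continuous_on UNIV (\<lambda>y::real ^ 'm. case_sum (($) x) (($) y) i)" for i :: "'n + 'm"
    by (cases i) (auto intro!: continuous_intros)
  then show ?thesis unfolding poly_at2_def[abs_def] mpoly_eval_def monom_eval_def
    by (intro continuous_intros)
qed

lemma integrable_algebra_poly_at2:
  fixes \<nu> :: "(real ^ 'm::finite) measure" and x :: "real ^ 'n::finite"
  assumes "finite_moments \<nu>"
  shows "integrable_algebra \<nu> (range (\<lambda>p. poly_at2 p x))" (is "integrable_algebra \<nu> ?P")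
proof
  show "(\<lambda>_. c) \<in> ?P" for c
    by (rule range_eqI[of _ _ "const c"]) (simp add: poly_at2_def fun_eq_iff)
next
  fix p q assume "p \<in> ?P" "q \<in> ?P"
  then obtain p' q' where "p = poly_at2 p' x" "q = poly_at2 q' x" by blast
  then have "(\<lambda>y. p y + q y) = poly_at2 (p' + q') x" "(\<lambda>y. p y * q y) = poly_at2 (p' * q') x"
    by (auto simp: poly_at2_def mpoly_eval_add mpoly_eval_mult)
  then show "(\<lambda>y. p y + q y) \<in> ?P" "(\<lambda>y. p y * q y) \<in> ?P"
    by blast+
next
  show "integrable \<nu> p" if "p \<in> ?P" for p
    using that integrable_poly_at2[OF assms] by auto
qed

text \<open>The integrands \<open>\<tau>\<^sub>j(x,y) g\<^sub>j(x,y)\<close> are nonnegative for \<open>\<nu>\<close>-almost every \<open>y\<close>, since the complement of the support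
is a null set.\<close>
lemma QM_measure_nonneg_on_K:
  fixes \<nu> :: "(real ^ 'm::finite) measure" and g :: "nat \<Rightarrow> ('n::finite + 'm) mpoly"
  assumes sets: "sets \<nu> = sets borel" and fin: "finite_moments \<nu>"
    and K: "\<And>y j. y \<in> measure_support \<nu> \<Longrightarrow> j \<in> {1..s} \<Longrightarrow> poly_at2 (g j) x y \<ge> 0"
    and p: "p \<in> QM_measure s g \<nu>"
  shows "poly_at p x \<ge> 0"
proof -
  obtain \<tau> where \<tau>: "\<forall>j\<le>s. \<tau> j \<in> sos"
    and eq: "p = (\<Sum>j\<le>s. partial_integral \<nu> (\<tau> j * (if j = 0 then 1 else g j)))"
    using p unfolding QM_measure_def by blast
  have "poly_at (partial_integral \<nu> (\<tau> j * (if j = 0 then 1 else g j))) x \<ge> 0" if "j \<le> s" for j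
    unfolding poly_at_partial_integral[OF fin]
  proof (rule integral_nonneg_AE)
    show "AE y in \<nu>. 0 \<le> poly_at2 (\<tau> j * (if j = 0 then 1 else g j)) x y"
      using AE_measure_support[OF sets]
    proof eventually_elim
      case (elim y)
      have "poly_at2 (if j = 0 then 1 else g j) x y \<ge> 0"
        using K[OF elim, of j] \<open>j \<le> s\<close> by (auto simp: poly_at2_def)
      then show ?case using \<tau> \<open>j \<le> s\<close>
        by (simp add: poly_at2_def mpoly_eval_mult mpoly_eval_sos)
    qed
  qed
  then show ?thesis unfolding eq poly_at_def mpoly_eval_sum by (intro sum_nonneg) simp
qed

text \<open>Squares \<open>q(x,y)\<^sup>2\<close> as multipliers of \<open>g\<^sub>j\<close> provide, at the fixed point \<open>x\<close>, all squares of polynomials in \<open>y\<close>.\<close>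
lemma QM_measure_nonneg_imp_K:
  fixes \<nu> :: "(real ^ 'm::finite) measure" and g :: "nat \<Rightarrow> ('n::finite + 'm) mpoly"
  assumes sets: "sets \<nu> = sets borel" and fin: "finite_moments \<nu>" and carleman: "multivariate_carleman \<nu>"
    and nonneg: "\<And>p. p \<in> QM_measure s g \<nu> \<Longrightarrow> poly_at p x \<ge> 0"
    and j: "j \<in> {1..s}" and y: "y \<in> measure_support \<nu>"
  shows "poly_at2 (g j) x y \<ge> 0"
proof (rule localized_nonneg_imp_nonneg_on_support[OF sets carleman integrable_algebra_poly_at2[OF fin, of x] _ _ _ _ y])
  show "(\<lambda>y. y $ k) \<in> range (\<lambda>p. poly_at2 p x)" for k
    by (rule range_eqI[of _ _ "var (Inr k)"]) (simp add: poly_at2_def mpoly_eval_var fun_eq_iff)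
  show "poly_at2 (g j) x \<in> range (\<lambda>p. poly_at2 p x)" by blast
  show "continuous_on UNIV (poly_at2 (g j) x)" by (rule continuous_on_poly_at2)
  fix q :: "real ^ 'm \<Rightarrow> real" assume "q \<in> range (\<lambda>p. poly_at2 p x)"
  then obtain q' where q': "q = poly_at2 q' x" by blast
  have "0 \<le> poly_at (partial_integral \<nu> (q'\<^sup>2 * g j)) x"
    by (intro nonneg QM_measure_generator[OF j] sos_square)
  also have "\<dots> = (\<integral>y. (q y)\<^sup>2 * poly_at2 (g j) x y \<partial>\<nu>)"
    unfolding poly_at_partial_integral[OF fin] q'
    by (rule Bochner_Integration.integral_cong) (simp_all add: poly_at2_def mpoly_eval_mult mpoly_eval_power)
  finally show "0 \<le> (\<integral>y. (q y)\<^sup>2 * poly_at2 (g j) x y \<partial>\<nu>)" .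
qed

theorem proposition5p1:
  fixes Q :: "(real ^ 'm::finite) set"
    and s :: nat and g :: "nat \<Rightarrow> ('n::finite + 'm) mpoly"
    and \<nu> :: "(real ^ 'm) measure"
    and I J :: "'i set" and c :: "'i \<Rightarrow> 'n mpoly"
    and f :: "'n mpoly"
    and K X :: "(real ^ 'n) set" and M :: "'n mpoly set"
  defines "K \<equiv> {x. \<forall>y\<in>Q. \<forall>j\<in>{1..s}. poly_at2 (g j) x y \<ge> 0}"
    and "X \<equiv> {x. (\<forall>i\<in>I. poly_at (c i) x = 0) \<and> (\<forall>j\<in>J. poly_at (c j) x \<ge> 0)}"
    and "M \<equiv> QM_measure s g \<nu> + Ideal I c + QM J c"
  assumes "closed Q"
    and "finite_measure \<nu>" and "sets \<nu> = sets borel"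
    and "finite_moments \<nu>"
    and "measure_support \<nu> = Q"
    and "multivariate_carleman \<nu>"
    and "finite I" and "finite J" and "I \<inter> J = {}"
    and "archimedean M"
  shows "(INF x\<in>X \<inter> K. ereal (poly_at f x)) =
    (INF z\<in>{z. (\<forall>p\<in>M. Riesz z p \<ge> 0) \<and> Riesz z 1 = 1}. ereal (Riesz z f))"
proof -
  note sets = \<open>sets \<nu> = sets borel\<close> and fin = \<open>finite_moments \<nu>\<close>
    and supp = \<open>measure_support \<nu> = Q\<close> and carleman = \<open>multivariate_carleman \<nu>\<close>
  note sub = quadratic_module_sum(2-4)[where s = s and g = g and \<nu> = \<nu> and I = I and J = J and c = c, folded M_def]
  have arch: "order_unit_module M"
    using archimedean_imp_order_unit_module[OF _ \<open>archimedean M\<close>] quadratic_module_sum(1) unfolding M_def by blast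
  have nonneg: "poly_at p x \<ge> 0" if "x \<in> X \<inter> K" "p \<in> M" for x p
  proof -
    obtain p1 p2 p3 where p: "p = p1 + p2 + p3" "p1 \<in> QM_measure s g \<nu>" "p2 \<in> Ideal I c" "p3 \<in> QM J c"
      using \<open>p \<in> M\<close> unfolding M_def by (elim set_plus_elim) blast
    have "poly_at p1 x \<ge> 0"
      by (rule QM_measure_nonneg_on_K[OF sets fin _ p(2)]) (use that(1) supp K_def in auto)
    moreover have "poly_at p2 x = 0" unfolding poly_at_def
      by (rule mpoly_eval_Ideal[OF p(3)]) (use that(1) in \<open>auto simp: X_def poly_at_def\<close>)
    moreover have "poly_at p3 x \<ge> 0" unfolding poly_at_def
      by (rule mpoly_eval_QM[OF p(4)]) (use that(1) in \<open>auto simp: X_def poly_at_def\<close>)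
    ultimately show ?thesis unfolding p(1) poly_at_def by (simp add: mpoly_eval_add)
  qed
  have feasible: "x \<in> X \<inter> K" if nn: "\<And>p. p \<in> M \<Longrightarrow> poly_at p x \<ge> 0" for x
  proof
    have "poly_at (c i) x = 0" if "i \<in> I" for i
    proof -
      have "poly_at (c i) x \<ge> 0" "poly_at (- c i) x \<ge> 0" using nn sub(2) Ideal_generator[OF that] by blast+
      moreover have "poly_at (c i) x + poly_at (- c i) x = 0"
        unfolding poly_at_def mpoly_eval_add[symmetric] by simp
      ultimately show ?thesis by linarith
    qed
    moreover have "poly_at (c j) x \<ge> 0" if "j \<in> J" for j
      using nn sub(3) QM_generator[OF \<open>finite J\<close> that] by blast
    ultimately show "x \<in> X" unfolding X_def by blast
    show "x \<in> K" unfolding K_def supp[symmetric]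
      using QM_measure_nonneg_imp_K[OF sets fin carleman] nn sub(1) by blast
  qed
  have point: "(INF z\<in>{z. (\<forall>p\<in>M. Riesz z p \<ge> 0) \<and> Riesz z 1 = 1}. ereal (Riesz z f)) \<le> ereal (poly_at f x)"
    if x: "x \<in> X \<inter> K" for x
  proof -
    have Riesz: "Riesz (monom_eval (($) x)) = (\<lambda>p. poly_at p x)"
      by (rule ext) (simp add: poly_at_def mpoly_eval_eq_Riesz)
    have "Riesz (monom_eval (($) x)) 1 = 1" unfolding Riesz poly_at_def by simp
    then have "monom_eval (($) x) \<in> {z. (\<forall>p\<in>M. Riesz z p \<ge> 0) \<and> Riesz z 1 = 1}"
      using nonneg[OF x] by (simp add: Riesz)
    from INF_lower[OF this, of "\<lambda>z. ereal (Riesz z f)"] show ?thesis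
      by (simp only: fun_cong[OF Riesz])
  qed
  have bound: "(INF x\<in>X \<inter> K. ereal (poly_at f x)) \<le> ereal (Riesz z f)"
    if z: "\<forall>p\<in>M. Riesz z p \<ge> 0" "Riesz z 1 = 1" for z
  proof (rule ccontr)
    assume "\<not> ?thesis"
    then have "ereal (Riesz z f) < (INF x\<in>X \<inter> K. ereal (poly_at f x))" by simp
    from ereal_dense2[OF this] obtain l where l: "ereal (Riesz z f) < ereal l"
      "ereal l < (INF x\<in>X \<inter> K. ereal (poly_at f x))" by blast
    have "f - const l \<in> M"
    proof (rule archimedean_positivstellensatz[OF arch])
      fix \<alpha> assume hom: "real_hom \<alpha>" and nn: "\<And>a. a \<in> M \<Longrightarrow> \<alpha> a \<ge> 0"
      define x where "x = (\<chi> i. \<alpha> (var i))"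
      have eval: "\<alpha> p = poly_at p x" for p
        using real_hom_eq_mpoly_eval[OF hom, of p] by (simp add: poly_at_def x_def)
      have "x \<in> X \<inter> K" using feasible nn unfolding eval by blast
      from less_le_trans[OF l(2) INF_lower[OF this]] have "l < poly_at f x" by simp
      moreover have "poly_at (f - const l) x + l = poly_at f x"
        using mpoly_eval_add[of "($) x" "f - const l" "const l"] by (simp add: poly_at_def)
      ultimately show "\<alpha> (f - const l) > 0" unfolding eval by linarith
    qed
    then have "Riesz z (f - const l) \<ge> 0" using z(1) by blast
    moreover have "Riesz z f = Riesz z (f - const l) + Riesz z (const l)" 
      using Riesz_add[of z "f - const l" "const l"] by (simp only: diff_add_cancel)
    moreover have "Riesz z (const l) = l"
      using z(2) Riesz_single[of z 0 1] by simp
    ultimately have "Riesz z f \<ge> l" by linarith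
    then show False using l(1) by simp
  qed
  show ?thesis
    by (rule antisym) (use point bound in \<open>auto intro!: INF_greatest\<close>)
qed

end
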